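(* Let $a,b,s\in\mathbb{R}$ with $s\neq0$. The set $\Phi=\{\phi_{1,n}\mid n\geq0\}\cup\{\phi_{2,m}\mid m\geq0\}$ forms a Riesz basis of $\mathcal{H}^0$. Moreover, the operator $\mathcal{A}$ generates a $C_0$-semigroup (on $\mathcal{H}^0$).
   Context: $\mathbb{N}=\{0,1,2,\ldots\}$. $\mathcal{H}^0=L^2(0,1)\times L^2(0,1)$ with inner product $\langle(f_1,g_1),(f_2,g_2)\rangle=\int_0^1(f_1f_2+g_1g_2)\,dx$. The operator $\mathcal{A}$ on $\mathcal{H}^0$ is $\mathcal{A}(f,g)=(f''+af,g''+bg)$ with domain $D(\mathcal{A})=\{(f,g)\in H^2(0,1)\times H^2(0,1)\mid f(1)=g'(0)=g'(1)=0,\ f'(0)=sg(0)\}$. $\Delta(a,b)=\{(n,m)\in\mathbb{N}^2\mid4(b-a)=(4m^2-(2n+1)^2)\pi^2\}$ and $\Delta_2(a,b)=\{m\in\mathbb{N}\mid\exists n\in\mathbb{N},\ (n,m)\in\Delta(a,b)\}$. $\mu_0=1$ and $\mu_m=\sqrt2$ for $m\ge1$. $\phi_{1,n}=(\phi_{1,n}^1,\phi_{1,n}^2)$ with $\phi_{1,n}^1(x)=\sqrt2\cos((n+1/2)\pi x)$, $\phi_{1,n}^2=0$. $\phi_{2,m}=(\phi_{2,m}^1,\phi_{2,m}^2)$ with $\phi_{2,m}^2(x)=\mu_m\cos(m\pi x)$ and: for $m\notin\Delta_2(a,b)$ with $b-a=m^2\pi^2$, $\phi_{2,m}^1(x)=s\mu_m(-1+x)$;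 for $m\notin\Delta_2(a,b)$ with $b-a\neq m^2\pi^2$, $\phi_{2,m}^1(x)=-\frac{s\mu_m}{r_m\cosh(r_m)}\sinh(r_m(1-x))$ where $r_m$ is one of the two (complex) square roots of $b-a-m^2\pi^2$ (this function is real-valued); for $m\in\Delta_2(a,b)$, with $k\in\mathbb{N}$ the integer such that $(k,m)\in\Delta(a,b)$, $\phi_{2,m}^1(x)=\frac{s\mu_m}{(k+1/2)\pi}(1-x)\sin((k+1/2)\pi x)$. *)

theory Defs
  imports "HOL-Analysis.Analysis"
begin

section \<open>The real Hilbert space $L^2(0,1)$\<close>

definition square_integrable :: "(real \<Rightarrow> real) \<Rightarrow> bool" where
  "square_integrable f \<longleftrightarrow> f \<in> borel_measurable (lebesgue_on {0<..<1}) \<and>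
     integrable (lebesgue_on {0<..<1}) (\<lambda>x. (f x)\<^sup>2)"

definition l2_eq :: "(real \<Rightarrow> real) \<Rightarrow> (real \<Rightarrow> real) \<Rightarrow> bool" where
  "l2_eq f g \<longleftrightarrow> square_integrable f \<and> square_integrable g \<and>
     (AE x in lebesgue_on {0<..<1}. f x = g x)"

lemma square_integrable_measurable:
  "square_integrable f \<Longrightarrow> f \<in> borel_measurable (lebesgue_on {0<..<1})"
  by (simp add: square_integrable_def)

lemma l2_integrable_mult:
  assumes "square_integrable f" "square_integrable g"
  shows "integrable (lebesgue_on {0<..<1}) (\<lambda>x. f x * g x)"
proof (rule Bochner_Integration.integrable_bound)
  show "integrable (lebesgue_on {0<..<1}) (\<lambda>x. (f x)\<^sup>2 + (g x)\<^sup>2)"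
    using assms by (simp add: square_integrable_def)
  show "(\<lambda>x. f x * g x) \<in> borel_measurable (lebesgue_on {0<..<1})"
    using assms by (intro borel_measurable_times square_integrable_measurable)
  have "\<bar>u * v\<bar> \<le> u\<^sup>2 + v\<^sup>2" for u v :: real
  proof -
    have "2 * \<bar>u * v\<bar> \<le> u\<^sup>2 + v\<^sup>2"
      using sum_squares_bound[of "\<bar>u\<bar>" "\<bar>v\<bar>"] by (simp add: abs_mult mult.assoc)
    then show ?thesis by linarith
  qed
  then show "AE x in lebesgue_on {0<..<1}. norm (f x * g x) \<le> norm ((f x)\<^sup>2 + (g x)\<^sup>2)"
    by simp
qed

lemma square_integrable_add:
  assumes "square_integrable f" "square_integrable g"
  shows "square_integrable (\<lambda>x. f x + g x)"
  using assms l2_integrable_mult[OF assms]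
  by (auto simp: square_integrable_def power2_sum mult.assoc intro: borel_measurable_add)

lemma square_integrable_cmult:
  "square_integrable f \<Longrightarrow> square_integrable (\<lambda>x. c * f x)"
  by (auto simp: square_integrable_def power_mult_distrib
      intro: borel_measurable_times borel_measurable_const)

lemma square_integrable_uminus:
  "square_integrable f \<Longrightarrow> square_integrable (\<lambda>x. - f x)"
  by (simp add: square_integrable_def)

lemma square_integrable_diff:
  assumes "square_integrable f" "square_integrable g"
  shows "square_integrable (\<lambda>x. f x - g x)"
  using square_integrable_add[OF assms(1) square_integrable_uminus[OF assms(2)]] by simp

lemma square_integrable_zero: "square_integrable (\<lambda>x. 0)"
  by (simp add: square_integrable_def)

lemma square_integrable_continuous:
  assumes "continuous_on {0..1} f"
  shows "square_integrable f"
proof -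
  have ac: "h absolutely_integrable_on {0<..<1}" if "continuous_on {0..1} h"
    for h :: "real \<Rightarrow> real"
    by (rule set_integrable_subset[OF absolutely_integrable_continuous_real[OF that]]) auto
  have i: "integrable (lebesgue_on {0<..<1}) h" if "continuous_on {0..1} h"
    for h :: "real \<Rightarrow> real"
    using ac[OF that] by (simp add: integrable_restrict_space set_integrable_def)
  have "integrable (lebesgue_on {0<..<1}) f"
    by (rule i[OF assms])
  moreover have "integrable (lebesgue_on {0<..<1}) (\<lambda>x. (f x)\<^sup>2)"
    by (intro i continuous_intros assms)
  ultimately show ?thesis
    by (auto simp: square_integrable_def intro: borel_measurable_integrable)
qed

quotient_type l2 = "real \<Rightarrow> real" / partial: l2_eq
proof (rule part_equivpI)
  show "\<exists>f. l2_eq f f"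
    using square_integrable_zero by (auto simp: l2_eq_def)
  show "symp l2_eq"
    by (auto simp: symp_def l2_eq_def eq_commute elim: AE_mp)
  show "transp l2_eq"
    unfolding transp_def l2_eq_def by (auto elim: AE_mp)
qed

text \<open>The class of a square integrable function; other functions are sent to \<open>0\<close>.\<close>

lift_definition l2_of :: "(real \<Rightarrow> real) \<Rightarrow> l2" is
  "\<lambda>f. if square_integrable f then f else (\<lambda>x. 0)"
  by (simp add: l2_eq_def square_integrable_zero)

instantiation l2 :: real_inner
begin

lift_definition zero_l2 :: l2 is "\<lambda>x. 0"
  by (simp add: l2_eq_def square_integrable_zero)

lift_definition plus_l2 :: "l2 \<Rightarrow> l2 \<Rightarrow> l2" is "\<lambda>f g x. f x + g x"
  by (auto simp: l2_eq_def square_integrable_add elim: AE_mp)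

lift_definition minus_l2 :: "l2 \<Rightarrow> l2 \<Rightarrow> l2" is "\<lambda>f g x. f x - g x"
  by (auto simp: l2_eq_def square_integrable_diff elim: AE_mp)

lift_definition uminus_l2 :: "l2 \<Rightarrow> l2" is "\<lambda>f x. - f x"
  by (auto simp: l2_eq_def square_integrable_uminus elim: AE_mp)

lift_definition scaleR_l2 :: "real \<Rightarrow> l2 \<Rightarrow> l2" is "\<lambda>c f x. c * f x"
  by (auto simp: l2_eq_def square_integrable_cmult elim: AE_mp)

lift_definition inner_l2 :: "l2 \<Rightarrow> l2 \<Rightarrow> real" is
  "\<lambda>f g. integral\<^sup>L (lebesgue_on {0<..<1}) (\<lambda>x. f x * g x)"
  by (rule integral_cong_AE) (auto simp: l2_eq_def square_integrable_def elim: AE_mp)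

definition norm_l2 :: "l2 \<Rightarrow> real" where "norm_l2 u = sqrt (inner u u)"

definition sgn_l2 :: "l2 \<Rightarrow> l2" where "sgn_l2 u = inverse (norm u) *\<^sub>R u"

definition dist_l2 :: "l2 \<Rightarrow> l2 \<Rightarrow> real" where "dist_l2 u v = norm (u - v)"

definition uniformity_l2 :: "(l2 \<times> l2) filter" where
  "uniformity_l2 = (INF e\<in>{0<..}. principal {(u, v). dist u v < e})"

definition open_l2 :: "l2 set \<Rightarrow> bool" where
  "open_l2 U \<longleftrightarrow> (\<forall>u\<in>U. \<forall>\<^sub>F (u', v) in uniformity. u' = u \<longrightarrow> v \<in> U)"

instance
proof
  fix u v w :: l2 and c d :: real and U :: "l2 set"
  show "u + v + w = u + (v + w)" "u + v = v + u" "0 + u = u" "- u + u = 0" "u - v = u + - v"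
    "c *\<^sub>R (u + v) = c *\<^sub>R u + c *\<^sub>R v" "(c + d) *\<^sub>R u = c *\<^sub>R u + d *\<^sub>R u"
    "c *\<^sub>R d *\<^sub>R u = (c * d) *\<^sub>R u" "1 *\<^sub>R u = u"
    by (transfer, simp add: l2_eq_def algebra_simps square_integrable_add square_integrable_diff
        square_integrable_uminus square_integrable_cmult square_integrable_zero)+
  show "sgn u = inverse (norm u) *\<^sub>R u" "dist u v = norm (u - v)"
    "uniformity = (INF e\<in>{0<..}. principal {(u::l2, v). dist u v < e})"
    "open U = (\<forall>u\<in>U. \<forall>\<^sub>F (u', v) in uniformity. u' = u \<longrightarrow> v \<in> U)"
    "norm u = sqrt (inner u u)"
    by (simp_all add: sgn_l2_def dist_l2_def uniformity_l2_def open_l2_def norm_l2_def)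
  show "inner u v = inner v u"
    by transfer (simp add: mult.commute)
  show "inner (u + v) w = inner u w + inner v w"
    by transfer (simp add: l2_eq_def distrib_right l2_integrable_mult)
  show "inner (c *\<^sub>R u) v = c * inner u v"
    by transfer (simp add: mult.assoc)
  show "0 \<le> inner u u"
    by transfer simp
  show "inner u u = 0 \<longleftrightarrow> u = 0"
  proof transfer
    fix f assume "l2_eq f f"
    then have f: "square_integrable f" by (simp add: l2_eq_def)
    have "integral\<^sup>L (lebesgue_on {0<..<1}) (\<lambda>x. f x * f x) = 0 \<longleftrightarrow>
        (AE x in lebesgue_on {0<..<1}. f x * f x = 0)"
      by (rule integral_nonneg_eq_0_iff_AE) (auto intro: l2_integrable_mult f)
    then show "integral\<^sup>L (lebesgue_on {0<..<1}) (\<lambda>x. f x * f x) = 0 \<longleftrightarrow> l2_eq f (\<lambda>x. 0)"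
      by (simp add: l2_eq_def f square_integrable_zero)
  qed
qed

end

lemma l2_of_rep: "\<exists>f. square_integrable f \<and> u = l2_of f"
proof transfer
  fix f assume "l2_eq f f"
  then show "\<exists>g. square_integrable g \<and> l2_eq f (if square_integrable g then g else (\<lambda>x. 0))"
    by (intro exI[of _ f]) (auto simp: l2_eq_def)
qed

lemma l2_of_eq_iff:
  assumes "square_integrable f" "square_integrable g"
  shows "l2_of f = l2_of g \<longleftrightarrow> (AE x in lebesgue_on {0<..<1}. f x = g x)"
  using assms by transfer (simp add: l2_eq_def)

lemma l2_of_diff:
  assumes "square_integrable f" "square_integrable g"
  shows "l2_of (\<lambda>x. f x - g x) = l2_of f - l2_of g"
  using assms by transfer (simp add: l2_eq_def square_integrable_diff)

lemma inner_l2_of: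
  assumes "square_integrable f" "square_integrable g"
  shows "inner (l2_of f) (l2_of g) = integral\<^sup>L (lebesgue_on {0<..<1}) (\<lambda>x. f x * g x)"
  using assms by transfer simp

lemma norm_l2_of:
  assumes "square_integrable f"
  shows "(norm (l2_of f))\<^sup>2 = integral\<^sup>L (lebesgue_on {0<..<1}) (\<lambda>x. (f x)\<^sup>2)"
  unfolding power2_norm_eq_inner inner_l2_of[OF assms assms] by (simp add: power2_eq_square)

lemma nn_integral_l2_of:
  assumes "square_integrable f"
  shows "(\<integral>\<^sup>+x. ennreal ((f x)\<^sup>2) \<partial>lebesgue_on {0<..<1}) = ennreal ((norm (l2_of f))\<^sup>2)"
  unfolding norm_l2_of[OF assms]
  using assms by (intro nn_integral_eq_integral) (auto simp: square_integrable_def)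

lemma nn_integral_abs_le_norm:
  assumes "square_integrable f"
  shows "(\<integral>\<^sup>+x. ennreal \<bar>f x\<bar> \<partial>lebesgue_on {0<..<1}) \<le> ennreal (norm (l2_of f))"
proof -
  have f': "square_integrable (\<lambda>x. \<bar>f x\<bar>)"
    using assms by (auto simp: square_integrable_def)
  have one: "square_integrable (\<lambda>x. 1)"
    by (rule square_integrable_continuous) simp
  have n: "norm (l2_of (\<lambda>x. \<bar>f x\<bar>)) = norm (l2_of f)"
    by (rule power2_eq_imp_eq) (simp_all add: norm_l2_of assms f')
  have "(norm (l2_of (\<lambda>x. 1)))\<^sup>2 = 1"
    using norm_l2_of[OF one] by (simp add: measure_restrict_space)
  then have n1: "norm (l2_of (\<lambda>x. 1)) = 1"
    by (metis norm_ge_zero one_power2 power2_eq_imp_eq zero_le_one)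
  have "integrable (lebesgue_on {0<..<1}) (\<lambda>x. \<bar>f x\<bar>)"
    using l2_integrable_mult[OF f' one] by simp
  then have "(\<integral>\<^sup>+x. ennreal \<bar>f x\<bar> \<partial>lebesgue_on {0<..<1})
      = ennreal (integral\<^sup>L (lebesgue_on {0<..<1}) (\<lambda>x. \<bar>f x\<bar>))"
    by (intro nn_integral_eq_integral) auto
  also have "\<dots> = ennreal (inner (l2_of (\<lambda>x. \<bar>f x\<bar>)) (l2_of (\<lambda>x. 1)))"
    by (simp add: inner_l2_of f' one)
  also have "\<dots> \<le> ennreal (norm (l2_of f))"
    using norm_cauchy_schwarz[of "l2_of (\<lambda>x. \<bar>f x\<bar>)" "l2_of (\<lambda>x. 1)"]
    by (intro ennreal_leI) (simp add: n n1)
  finally show ?thesis .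
qed

instance l2 :: complete_space
proof
  fix X :: "nat \<Rightarrow> l2"
  assume X: "Cauchy X"
  let ?M = "lebesgue_on {0<..<1::real}"
  have "\<exists>N. \<forall>m\<ge>N. \<forall>n\<ge>N. norm (X m - X n) < (1/2)^k" for k
    using CauchyD[OF X, of "(1/2)^k"] by simp
  then obtain N where N: "\<And>k m n. m \<ge> N k \<Longrightarrow> n \<ge> N k \<Longrightarrow> norm (X m - X n) < (1/2)^k"
    by metis
  define r where "r k = k + Max (N ` {..k})" for k
  have rN: "N k \<le> r l" if "k \<le> l" for k l
    unfolding r_def using that by (intro trans_le_add2 Max_ge) auto
  have rge: "k \<le> r k" for k by (simp add: r_def)
  have "\<exists>f. square_integrable f \<and> X (r k) = l2_of f" for k
    by (rule l2_of_rep)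
  then obtain f where f: "\<And>k. square_integrable (f k)" "\<And>k. X (r k) = l2_of (f k)"
    by metis
  have [measurable]: "f k \<in> borel_measurable ?M" for k
    using f(1) by (rule square_integrable_measurable)
  have norm_f: "norm (l2_of (\<lambda>x. f l x - f k x)) \<le> (1/2)^k" if "k \<le> l" for k l
    using N[of k "r l" "r k"] rN[OF that] rN[of k k] by (simp add: l2_of_diff f)
  have "(\<integral>\<^sup>+x. (\<Sum>k. ennreal \<bar>f (Suc k) x - f k x\<bar>) \<partial>?M)
      = (\<Sum>k. \<integral>\<^sup>+x. ennreal \<bar>f (Suc k) x - f k x\<bar> \<partial>?M)"
    by (rule nn_integral_suminf) measurable
  also have "\<dots> \<le> (\<Sum>k. ennreal ((1/2)^k))"
    by (intro suminf_le allI order_trans[OF nn_integral_abs_le_norm] ennreal_leI norm_f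
        square_integrable_diff f) auto
  also have "\<dots> < \<infinity>"
    by (subst suminf_ennreal2) auto
  finally have "AE x in ?M. (\<Sum>k. ennreal \<bar>f (Suc k) x - f k x\<bar>) \<noteq> \<infinity>"
    by (intro nn_integral_PInf_AE) (auto, measurable)
  then have AE_conv: "AE x in ?M. (\<lambda>k. f k x) \<longlonglongrightarrow> lim (\<lambda>k. f k x)"
  proof eventually_elim
    case (elim x)
    have "summable (\<lambda>k. \<bar>f (Suc k) x - f k x\<bar>)"
      using elim by (intro summable_suminf_not_top) (auto simp: top_ennreal_def)
    then have "summable (\<lambda>k. f (Suc k) x - f k x)"
      by (rule summable_rabs_cancel)
    then have "convergent (\<lambda>n. \<Sum>k<n. f (Suc k) x - f k x)"
      by (simp add: summable_iff_convergent)
    then have "convergent (\<lambda>n. f n x - f 0 x)"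
      by (simp add: sum_lessThan_telescope[of "\<lambda>k. f k x"])
    then have "convergent (\<lambda>n. f n x)"
      using convergent_add[OF _ convergent_const[of "f 0 x"], of "\<lambda>n. f n x - f 0 x"] by simp
    then show ?case by (simp add: convergent_LIMSEQ_iff)
  qed
  define g where "g x = lim (\<lambda>k. f k x)" for x
  have g_meas [measurable]: "g \<in> borel_measurable ?M"
    unfolding g_def by measurable
  have fatou: "(\<integral>\<^sup>+x. ennreal ((g x - f k x)\<^sup>2) \<partial>?M) \<le> ennreal (((1/2)^k)\<^sup>2)" for k
  proof -
    have "(\<integral>\<^sup>+x. ennreal ((g x - f k x)\<^sup>2) \<partial>?M)
        = (\<integral>\<^sup>+x. liminf (\<lambda>l. ennreal ((f l x - f k x)\<^sup>2)) \<partial>?M)"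
    proof (rule nn_integral_cong_AE)
      show "AE x in ?M. ennreal ((g x - f k x)\<^sup>2) = liminf (\<lambda>l. ennreal ((f l x - f k x)\<^sup>2))"
        using AE_conv
      proof eventually_elim
        case (elim x)
        then have "(\<lambda>l. ennreal ((f l x - f k x)\<^sup>2)) \<longlonglongrightarrow> ennreal ((g x - f k x)\<^sup>2)"
          unfolding g_def by (intro tendsto_intros)
        then show ?case by (intro lim_imp_Liminf[symmetric] sequentially_bot)
      qed
    qed
    also have "\<dots> \<le> liminf (\<lambda>l. \<integral>\<^sup>+x. ennreal ((f l x - f k x)\<^sup>2) \<partial>?M)"
      by (rule nn_integral_liminf) measurable
    also have "\<dots> \<le> liminf (\<lambda>l. ennreal (((1/2)^k)\<^sup>2))"
    proof (rule Liminf_mono)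
      show "\<forall>\<^sub>F l in sequentially.
          (\<integral>\<^sup>+x. ennreal ((f l x - f k x)\<^sup>2) \<partial>?M) \<le> ennreal (((1/2)^k)\<^sup>2)"
        using eventually_ge_at_top[of k]
      proof eventually_elim
        case (elim l)
        then show ?case
          by (subst nn_integral_l2_of)
             (auto intro!: ennreal_leI power_mono norm_f square_integrable_diff f)
      qed
    qed
    also have "\<dots> = ennreal (((1/2)^k)\<^sup>2)"
      by (simp add: Liminf_const)
    finally show ?thesis .
  qed
  have gf: "square_integrable (\<lambda>x. g x - f k x)" for k
  proof -
    have "(\<integral>\<^sup>+x. ennreal ((g x - f k x)\<^sup>2) \<partial>?M) < \<infinity>"
      by (rule order_le_less_trans[OF fatou]) simp
    then have "integrable ?M (\<lambda>x. (g x - f k x)\<^sup>2)"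
      by (intro integrableI_nonneg) (auto, measurable)
    moreover have "(\<lambda>x. g x - f k x) \<in> borel_measurable ?M" by measurable
    ultimately show ?thesis by (simp add: square_integrable_def)
  qed
  have g: "square_integrable g"
    using square_integrable_add[OF gf[of 0] f(1)[of 0]] by simp
  have le: "norm (l2_of g - X (r k)) \<le> (1/2)^k" for k
  proof -
    have "ennreal ((norm (l2_of g - X (r k)))\<^sup>2) \<le> ennreal (((1/2)^k)\<^sup>2)"
      using fatou[of k] by (simp add: nn_integral_l2_of gf l2_of_diff g f)
    then show ?thesis
      by (simp add: ennreal_le_iff power_mono_iff)
  qed
  have "X \<longlonglongrightarrow> l2_of g"
  proof (rule metric_LIMSEQ_I)
    fix e :: real assume "0 < e"
    then obtain k where k: "(1/2)^k < e/2"
      using real_arch_pow_inv[of "e/2" "1/2"] by auto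
    have "dist (X n) (l2_of g) < e" if "n \<ge> N k" for n
    proof -
      have "norm (X n - l2_of g) \<le> norm (X n - X (r k)) + norm (l2_of g - X (r k))"
        using norm_triangle_ineq4[of "X n - X (r k)" "l2_of g - X (r k)"] by simp
      also have "\<dots> < e"
        using N[of k n "r k"] that rN[of k k] le[of k] k by simp
      finally show ?thesis by (simp add: dist_norm)
    qed
    then show "\<exists>no. \<forall>n\<ge>no. dist (X n) (l2_of g) < e" by blast
  qed
  then show "convergent X" by (auto simp: convergent_def)
qed

instance l2 :: banach ..

section \<open>Sobolev spaces on $(0,1)$\<close>

text \<open>Weak derivatives are taken against continuously differentiable test functions with compact
  support in the open interval; boundary values are values of the continuous representative.\<close>

definition has_weak_deriv :: "l2 \<Rightarrow> l2 \<Rightarrow> bool" where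
  "has_weak_deriv u v \<longleftrightarrow>
     (\<forall>\<phi> \<phi>'. (\<forall>x. (\<phi> has_real_derivative \<phi>' x) (at x)) \<longrightarrow> continuous_on UNIV \<phi>' \<longrightarrow>
        (\<exists>K. compact K \<and> K \<subseteq> {0<..<1} \<and> (\<forall>x. x \<notin> K \<longrightarrow> \<phi> x = 0)) \<longrightarrow>
        inner u (l2_of \<phi>') = - inner v (l2_of \<phi>))"

definition weak_deriv :: "l2 \<Rightarrow> l2" where
  "weak_deriv u = (THE v. has_weak_deriv u v)"

definition H1 :: "l2 set" where
  "H1 = {u. \<exists>v. has_weak_deriv u v}"

definition H2 :: "l2 set" where
  "H2 = {u \<in> H1. weak_deriv u \<in> H1}"

definition boundary_value :: "l2 \<Rightarrow> real \<Rightarrow> real" where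
  "boundary_value u x = (THE c. \<exists>F. continuous_on {0..1} F \<and> u = l2_of F \<and> c = F x)"

lemma boundary_value_l2_of:
  assumes F: "continuous_on {0..1} F" and x: "x \<in> {0..1}"
  shows "boundary_value (l2_of F) x = F x"
  unfolding boundary_value_def
proof (rule the_equality)
  show "\<exists>G. continuous_on {0..1} G \<and> l2_of F = l2_of G \<and> F x = G x"
    using F by blast
  fix c assume "\<exists>G. continuous_on {0..1} G \<and> l2_of F = l2_of G \<and> c = G x"
  then obtain G where G: "continuous_on {0..1} G" "l2_of F = l2_of G" "c = G x"
    by blast
  define C where "C = {y \<in> {0..1}. F y - G y = 0}"
  have C: "closed C"
    unfolding C_def by (intro continuous_closed_preimage_constant continuous_intros F G closed_atLeastAtMost)
  have "AE y in lebesgue_on {0<..<1}. F y = G y"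
    using G F by (simp add: l2_of_eq_iff square_integrable_continuous)
  then have "AE y \<in> {0<..<1} in lebesgue. y \<in> C"
    by (simp add: AE_restrict_space_iff C_def)
  then have "{0<..<1} \<subseteq> C"
    using mem_closed_if_AE_lebesgue_open[OF open_greaterThanLessThan C] by blast
  then have "{0..1} \<subseteq> C"
    using closure_minimal[OF _ C] by (metis closure_greaterThanLessThan zero_less_one)
  then show "c = F x"
    using x G by (auto simp: C_def)
qed

section \<open>Riesz bases and strongly continuous semigroups\<close>

definition riesz_basis :: "'a::{real_inner,complete_space} set \<Rightarrow> bool" where
  "riesz_basis B \<longleftrightarrow> closure (span B) = UNIV \<and>
     (\<exists>c>0. \<exists>C>0. \<forall>S a. finite S \<longrightarrow> S \<subseteq> B \<longrightarrow>
        c * (\<Sum>v\<in>S. (a v)\<^sup>2) \<le> (norm (\<Sum>v\<in>S. a v *\<^sub>R v))\<^sup>2 \<and>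
        (norm (\<Sum>v\<in>S. a v *\<^sub>R v))\<^sup>2 \<le> C * (\<Sum>v\<in>S. (a v)\<^sup>2))"

definition C0_semigroup :: "(real \<Rightarrow> 'a::banach \<Rightarrow>\<^sub>L 'a) \<Rightarrow> bool" where
  "C0_semigroup T \<longleftrightarrow> T 0 = id_blinfun \<and>
     (\<forall>t\<ge>0. \<forall>t'\<ge>0. T (t + t') = T t o\<^sub>L T t') \<and>
     (\<forall>x. ((\<lambda>t. blinfun_apply (T t) x) \<longlongrightarrow> x) (at_right 0))"

text \<open>An unbounded operator is given by its domain \<open>D\<close> and a function \<open>A\<close>, whose values
  outside \<open>D\<close> are irrelevant.\<close>

definition generates_C0_semigroup :: "'a::banach set \<Rightarrow> ('a \<Rightarrow> 'a) \<Rightarrow> bool" where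
  "generates_C0_semigroup D A \<longleftrightarrow> (\<exists>T. C0_semigroup T \<and>
     (\<forall>x y. ((\<lambda>t. (blinfun_apply (T t) x - x) /\<^sub>R t) \<longlongrightarrow> y) (at_right 0) \<longleftrightarrow> x \<in> D \<and> y = A x))"

section \<open>The operator and its generalized eigenvectors\<close>

definition opA :: "real \<Rightarrow> real \<Rightarrow> l2 \<times> l2 \<Rightarrow> l2 \<times> l2" where
  "opA a b = (\<lambda>(f, g). (weak_deriv (weak_deriv f) + a *\<^sub>R f, weak_deriv (weak_deriv g) + b *\<^sub>R g))"

definition domA :: "real \<Rightarrow> (l2 \<times> l2) set" where
  "domA s = {(f, g). f \<in> H2 \<and> g \<in> H2 \<and>
     boundary_value f 1 = 0 \<and> boundary_value (weak_deriv g) 0 = 0 \<and> boundary_value (weak_deriv g) 1 = 0 \<and>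
     boundary_value (weak_deriv f) 0 = s * boundary_value g 0}"

definition Delta :: "real \<Rightarrow> real \<Rightarrow> (nat \<times> nat) set" where
  "Delta a b = {(n, m). 4 * (b - a) = (4 * (real m)\<^sup>2 - (2 * real n + 1)\<^sup>2) * pi\<^sup>2}"

definition Delta2 :: "real \<Rightarrow> real \<Rightarrow> nat set" where
  "Delta2 a b = {m. \<exists>n. (n, m) \<in> Delta a b}"

definition mu :: "nat \<Rightarrow> real" where
  "mu m = (if m = 0 then 1 else sqrt 2)"

definition phi1 :: "nat \<Rightarrow> l2 \<times> l2" where
  "phi1 n = (l2_of (\<lambda>x. sqrt 2 * cos ((real n + 1/2) * pi * x)), 0)"

definition phi21 :: "real \<Rightarrow> real \<Rightarrow> real \<Rightarrow> (nat \<Rightarrow> complex) \<Rightarrow> nat \<Rightarrow> real \<Rightarrow> real" where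
  "phi21 a b s r m x =
     (if m \<in> Delta2 a b then
        let k = (THE k. (k, m) \<in> Delta a b)
        in s * mu m / ((real k + 1/2) * pi) * (1 - x) * sin ((real k + 1/2) * pi * x)
      else if b - a = (real m)\<^sup>2 * pi\<^sup>2 then s * mu m * (-1 + x)
      else Re (- (of_real (s * mu m) / (r m * cosh (r m))) * sinh (r m * of_real (1 - x))))"

definition phi2 :: "real \<Rightarrow> real \<Rightarrow> real \<Rightarrow> (nat \<Rightarrow> complex) \<Rightarrow> nat \<Rightarrow> l2 \<times> l2" where
  "phi2 a b s r m = (l2_of (phi21 a b s r m), l2_of (\<lambda>x. mu m * cos (real m * pi * x)))"

text \<open>The real part in \<open>phi21\<close> only changes the type: the complex expression is real when
  \<open>r m\<close> is a square root of a real number.\<close>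

lemma phi21_complex_real:
  fixes z :: complex
  assumes "z\<^sup>2 \<in> \<real>"
  shows "- (of_real c / (z * cosh z)) * sinh (z * of_real y) \<in> \<real>"
proof -
  have "(cnj z)\<^sup>2 = z\<^sup>2"
    using assms by (metis Reals_cnj_iff complex_cnj_power)
  then have "cnj z = z \<or> cnj z = - z"
    by (simp add: power2_eq_iff)
  moreover have "cnj (sinh (z * of_real y)) = sinh (cnj z * of_real y)" "cnj (cosh z) = cosh (cnj z)"
    by (simp_all add: sinh_def cosh_def exp_cnj)
  ultimately show ?thesis
    by (auto simp: Reals_cnj_iff)
qed

end

theory Submission
  imports Defs
begin

text \<open>
  The Volterra type operator \<open>lift s g = - s \<integral>\<^sub>x\<^sup>1 g\<close> commutes with the second derivative on the
  Neumann domain, and \<open>lift s g\<close> has slope \<open>s g(0)\<close> at \<open>0\<close> and value \<open>0\<close> at \<open>1\<close>. Hence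
  \<open>(f, g) \<mapsto> (f - lift s g, g)\<close> removes the boundary coupling and turns the operator into the sum of
  two diagonal operators (in cosine bases) and the bounded triangular perturbation
  \<open>(f, g) \<mapsto> ((a - b) lift s g, 0)\<close>, whose semigroup is given by Duhamel's formula. No resolvents are
  needed, because the generator of a diagonal semigroup can be read off from coefficients.

  For the Riesz basis, \<open>phi1\<close> and the second components of \<open>phi2\<close> are orthonormal bases, and the
  first components of \<open>phi2\<close> are square summable in norm, being of size \<open>O(1/m)\<close>.
\<close>

section \<open>Orthonormal bases\<close>

text \<open>The coupling f'(0) = s g(0) is part of the domain, so it is no bounded perturbation of
  the decoupled operator; a change of variables must first move it into the action. Write L for
  \<open>lift s\<close> and h = f - L g. As (L g)' = s g, the condition g'(1) = 0 gives L(g'') = (L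
  g)'', and the first component f'' + a f - L(g'' + b g) of the transformed operator equals h'' + a
  h + (a - b) L g. This is the origin of the factor \<open>a - b\<close>. Weak derivatives and
  boundary values become algebra: an element of H^2 is a twice iterated primitive plus an affine
  function, so each domain condition is a linear equation in the second derivative and two
  constants. For the basis, the case distinction in \<open>phi21\<close> affects finitely many
  indices only. Once m \<ge> 1 and m \<ge> |b - a|, the number \<open>r m\<close> is imaginary and
  \<open>cosh (r m)\<close> is the cosine of a number within distance 1 of a multiple of pi, hence
  bounded away from 0. Resonant indices all lie below this threshold and cannot spoil square
  summability.\<close>

locale orthonormal_basis =
  fixes e :: "nat \<Rightarrow> 'a::{real_inner,banach}"
  assumes orthonormal: "inner (e i) (e j) = (if i = j then 1 else 0)"
    and dense_span: "closure (span (range e)) = UNIV"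
begin

lemma norm_sum_sq:
  assumes "finite S"
  shows "(norm (\<Sum>i\<in>S. c i *\<^sub>R e i))\<^sup>2 = (\<Sum>i\<in>S. (c i)\<^sup>2)"
proof -
  have "(norm (\<Sum>i\<in>S. c i *\<^sub>R e i))\<^sup>2 = (\<Sum>i\<in>S. \<Sum>j\<in>S. c i * (c j * (if j = i then 1 else 0)))"
    unfolding power2_norm_eq_inner inner_sum_left inner_sum_right
    by (simp add: orthonormal)
  also have "\<dots> = (\<Sum>i\<in>S. (c i)\<^sup>2)"
    using assms by (intro sum.cong refl) (simp add: power2_eq_square mult_delta_right)
  finally show ?thesis .
qed

text \<open>The vectors orthogonal to u form a closed subspace containing every \<open>e n\<close>,
  hence everything, hence u itself.\<close>

lemma eq_zero_if_coeffs_zero: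
  assumes "\<And>n. inner u (e n) = 0"
  shows "u = 0"
proof -
  have "closure (span (range e)) \<subseteq> {v. inner u v = 0}"
  proof (rule closure_minimal)
    show "span (range e) \<subseteq> {v. inner u v = 0}"
      by (rule span_minimal) (auto simp: assms subspace_def inner_add_right)
    show "closed {v. inner u v = 0}"
      by (intro closed_Collect_eq continuous_intros)
  qed
  then have "inner u u = 0"
    unfolding dense_span by blast
  then show ?thesis by simp
qed

lemma eq_if_coeffs_eq:
  assumes "\<And>n. inner u (e n) = inner v (e n)"
  shows "u = v"
  using eq_zero_if_coeffs_zero[of "u - v"] assms by (simp add: inner_diff_left)

lemma summable_series:
  assumes "summable (\<lambda>n. (c n)\<^sup>2)"
  shows "summable (\<lambda>n. c n *\<^sub>R e n)"
  unfolding summable_Cauchy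
proof (intro allI impI)
  fix \<epsilon> :: real assume "0 < \<epsilon>"
  then have "0 < \<epsilon>\<^sup>2" by simp
  then obtain N where N: "\<And>m n. m \<ge> N \<Longrightarrow> norm (\<Sum>i=m..<n. (c i)\<^sup>2) < \<epsilon>\<^sup>2"
    using assms unfolding summable_Cauchy by blast
  have "norm (\<Sum>i=m..<n. c i *\<^sub>R e i) < \<epsilon>" if "m \<ge> N" for m n
  proof (rule power2_less_imp_less)
    show "(norm (\<Sum>i=m..<n. c i *\<^sub>R e i))\<^sup>2 < \<epsilon>\<^sup>2"
      using N[OF that, of n] by (simp add: norm_sum_sq)
  qed (use \<open>0 < \<epsilon>\<close> in simp)
  then show "\<exists>N. \<forall>m\<ge>N. \<forall>n. norm (\<Sum>i=m..<n. c i *\<^sub>R e i) < \<epsilon>" by blast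
qed

lemma inner_series:
  assumes "summable (\<lambda>n. (c n)\<^sup>2)"
  shows "inner (\<Sum>n. c n *\<^sub>R e n) (e k) = c k"
proof -
  have "(\<lambda>n. inner (c n *\<^sub>R e n) (e k)) sums inner (\<Sum>n. c n *\<^sub>R e n) (e k)"
    by (rule bounded_linear.sums[OF bounded_linear_inner_left summable_sums[OF summable_series[OF assms]]])
  moreover have "(\<lambda>n. inner (c n *\<^sub>R e n) (e k)) sums c k"
    by (rule sums_cong[THEN iffD1, OF _ sums_single[of k c]]) (simp add: orthonormal)
  ultimately show ?thesis by (rule sums_unique2)
qed

lemma norm_series:
  assumes "summable (\<lambda>n. (c n)\<^sup>2)"
  shows "(norm (\<Sum>n. c n *\<^sub>R e n))\<^sup>2 = (\<Sum>n. (c n)\<^sup>2)"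
proof -
  have "(\<lambda>N. (norm (\<Sum>n<N. c n *\<^sub>R e n))\<^sup>2) \<longlonglongrightarrow> (norm (\<Sum>n. c n *\<^sub>R e n))\<^sup>2"
    by (intro tendsto_intros summable_LIMSEQ summable_series assms)
  then have "(\<lambda>N. \<Sum>n<N. (c n)\<^sup>2) \<longlonglongrightarrow> (norm (\<Sum>n. c n *\<^sub>R e n))\<^sup>2"
    by (simp add: norm_sum_sq)
  then show ?thesis
    by (rule LIMSEQ_unique[OF _ summable_LIMSEQ[OF assms]])
qed

text \<open>Bessel's inequality: p is the orthogonal projection of u onto the first N basis vectors,
  so |u|^2 - |p|^2 = |u - p|^2 is nonnegative.\<close>

lemma summable_coeffs: "summable (\<lambda>n. (inner u (e n))\<^sup>2)"
proof (rule summableI_nonneg_bounded)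
  fix N
  define p where "p = (\<Sum>n<N. inner u (e n) *\<^sub>R e n)"
  have "inner u p = (norm p)\<^sup>2"
    unfolding p_def norm_sum_sq[OF finite_lessThan] by (simp add: inner_sum_right power2_eq_square)
  then have "(norm (u - p))\<^sup>2 = (norm u)\<^sup>2 - (norm p)\<^sup>2"
    by (simp add: power2_norm_eq_inner inner_diff_left inner_diff_right inner_commute)
  then show "(\<Sum>n<N. (inner u (e n))\<^sup>2) \<le> (norm u)\<^sup>2"
    using zero_le_power2[of "norm (u - p)"] by (simp add: p_def norm_sum_sq)
qed simp

lemma series_coeffs: "(\<Sum>n. inner u (e n) *\<^sub>R e n) = u"
  by (rule eq_if_coeffs_eq) (simp add: inner_series summable_coeffs)

lemma parseval: "(norm u)\<^sup>2 = (\<Sum>n. (inner u (e n))\<^sup>2)"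
  using norm_series[OF summable_coeffs, of u] by (simp add: series_coeffs)

text \<open>Dominated convergence for coefficient sequences: Parseval turns the norm into a series,
  and Tannery's theorem exchanges limit and sum. Strong continuity and the generator of diagonal
  semigroups both rest on it.\<close>

lemma tendsto_if_coeffs_tendsto:
  fixes v :: "'b \<Rightarrow> 'a"
  assumes lim: "\<And>n. ((\<lambda>t. inner (v t) (e n)) \<longlongrightarrow> inner w (e n)) F"
    and bound: "\<forall>\<^sub>F t in F. \<forall>n. \<bar>inner (v t) (e n) - inner w (e n)\<bar> \<le> M n"
    and M: "summable (\<lambda>n. (M n)\<^sup>2)" and F: "F \<noteq> bot"
  shows "(v \<longlongrightarrow> w) F"
proof -
  let ?a = "\<lambda>n t. (inner (v t) (e n) - inner w (e n))\<^sup>2"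
  have "((\<lambda>t. \<Sum>n. ?a n t) \<longlongrightarrow> (\<Sum>n::nat. 0)) F"
  proof (rule tannerys_theorem[THEN conjunct2, THEN conjunct2])
    show "((\<lambda>t. ?a n t) \<longlongrightarrow> 0) F" for n
      using tendsto_power[OF tendsto_diff[OF lim[of n] tendsto_const[of "inner w (e n)"]], of 2] by simp
    have le: "norm (?a n t) \<le> (M n)\<^sup>2"
      if "\<forall>n. \<bar>inner (v t) (e n) - inner w (e n)\<bar> \<le> M n" for n t
      using power_mono[OF that[rule_format, of n] abs_ge_zero, of 2] by simp
    \<comment> \<open>Tannery's theorem wants the bound eventually in n and t jointly; here it holds
      for all n at once, so the filter in the n direction contributes \<open>True\<close>.\<close>
    show "\<forall>\<^sub>F (n, t) in at_top \<times>\<^sub>F F. norm (?a n t) \<le> (M n)\<^sup>2"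
      using eventually_prodI[OF eventually_True bound, of at_top]
    proof (rule eventually_mono)
      fix p :: "nat \<times> 'b"
      assume "True \<and> (\<forall>n. \<bar>inner (v (snd p)) (e n) - inner w (e n)\<bar> \<le> M n)"
      then show "case p of (n, t) \<Rightarrow> norm (?a n t) \<le> (M n)\<^sup>2"
        unfolding case_prod_beta by (intro le) (rule conjunct2)
    qed
    show "F \<noteq> bot" by (rule F)
  qed (rule M)
  then have "((\<lambda>t. sqrt ((norm (v t - w))\<^sup>2)) \<longlongrightarrow> sqrt 0) F"
    unfolding parseval by (intro tendsto_real_sqrt) (simp add: inner_diff_left)
  then have "((\<lambda>t. norm (v t - w)) \<longlongrightarrow> 0) F" by simp
  then show ?thesis
    by (rule LIM_zero_cancel[OF tendsto_norm_zero_cancel])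
qed

end

section \<open>Diagonal semigroups\<close>

text \<open>The eigenvalues are bounded above only, since those of interest tend to minus infinity.
  With \<omega> \<ge> 0 the bound \<open>exp (\<omega> * t)\<close> grows with t, so it is uniform
  over bounded time intervals.\<close>

locale spectral_semigroup = orthonormal_basis e for e :: "nat \<Rightarrow> 'a::{real_inner,banach}" +
  fixes lam :: "nat \<Rightarrow> real" and \<omega> :: real
  assumes lam_le: "lam n \<le> \<omega>" and \<omega>_nonneg: "0 \<le> \<omega>"
begin

definition dom :: "'a set" where
  "dom = {u. summable (\<lambda>n. (lam n * inner u (e n))\<^sup>2)}"

definition gen :: "'a \<Rightarrow> 'a" where
  "gen u = (\<Sum>n. (lam n * inner u (e n)) *\<^sub>R e n)"

definition sg :: "real \<Rightarrow> 'a \<Rightarrow> 'a" where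
  "sg t u = (\<Sum>n. (exp (lam n * t) * inner u (e n)) *\<^sub>R e n)"

text \<open>At negative times the multipliers \<open>exp (lam n * t)\<close> may be unbounded in n.
  The value 0 is a placeholder there, as \<open>C0_semigroup\<close> speaks of nonnegative
  times.\<close>

definition semigroup :: "real \<Rightarrow> 'a \<Rightarrow>\<^sub>L 'a" where
  "semigroup t = (if 0 \<le> t then Blinfun (sg t) else 0)"

lemma exp_le: "0 \<le> t \<Longrightarrow> exp (lam n * t) \<le> exp (\<omega> * t)"
  by (simp add: mult_right_mono lam_le)

lemma sg_coeff_sq_le:
  "0 \<le> t \<Longrightarrow> (exp (lam n * t) * inner u (e n))\<^sup>2 \<le> (exp (\<omega> * t))\<^sup>2 * (inner u (e n))\<^sup>2"
  unfolding power_mult_distrib by (intro mult_right_mono power_mono exp_le) auto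

lemma summable_sg_coeff: "0 \<le> t \<Longrightarrow> summable (\<lambda>n. (exp (lam n * t) * inner u (e n))\<^sup>2)"
  by (rule summable_comparison_test'[OF summable_mult[OF summable_coeffs[of u], of "(exp (\<omega> * t))\<^sup>2"], of 0])
     (use sg_coeff_sq_le in auto)

lemma inner_sg: "0 \<le> t \<Longrightarrow> inner (sg t u) (e n) = exp (lam n * t) * inner u (e n)"
  unfolding sg_def by (rule inner_series[OF summable_sg_coeff])

lemma norm_sg_le:
  assumes "0 \<le> t"
  shows "norm (sg t u) \<le> exp (\<omega> * t) * norm u"
proof (rule power2_le_imp_le)
  have "(norm (sg t u))\<^sup>2 = (\<Sum>n. (exp (lam n * t) * inner u (e n))\<^sup>2)"
    by (simp add: parseval inner_sg assms)
  also have "\<dots> \<le> (\<Sum>n. (exp (\<omega> * t))\<^sup>2 * (inner u (e n))\<^sup>2)"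
    by (intro suminf_le sg_coeff_sq_le summable_sg_coeff summable_mult summable_coeffs assms)
  also have "\<dots> = (exp (\<omega> * t) * norm u)\<^sup>2"
    by (subst suminf_mult[OF summable_coeffs]) (simp add: parseval power_mult_distrib)
  finally show "(norm (sg t u))\<^sup>2 \<le> (exp (\<omega> * t) * norm u)\<^sup>2" .
qed simp

lemma bounded_linear_sg:
  assumes "0 \<le> t"
  shows "bounded_linear (sg t)"
proof (rule bounded_linear_intro)
  show "sg t (u + v) = sg t u + sg t v" for u v
    by (rule eq_if_coeffs_eq) (simp add: inner_sg assms inner_add_left distrib_left)
  show "sg t (c *\<^sub>R u) = c *\<^sub>R sg t u" for c u
    by (rule eq_if_coeffs_eq) (simp add: inner_sg assms)
  show "norm (sg t u) \<le> norm u * exp (\<omega> * t)" for u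
    using norm_sg_le[OF assms, of u] by (simp add: mult.commute)
qed

lemma semigroup_apply: "0 \<le> t \<Longrightarrow> blinfun_apply (semigroup t) = sg t"
  by (simp add: semigroup_def bounded_linear_Blinfun_apply bounded_linear_sg)

lemma norm_semigroup_le: "0 \<le> t \<Longrightarrow> norm (semigroup t) \<le> exp (\<omega> * t)"
  by (rule norm_blinfun_bound) (auto simp: semigroup_apply norm_sg_le)

lemma continuous_sg: "continuous_on {0..} (\<lambda>t. sg t u)"
  unfolding continuous_on_def
proof
  fix t :: real assume t: "t \<in> {0..}"
  show "((\<lambda>t. sg t u) \<longlongrightarrow> sg t u) (at t within {0..})"
  proof (cases "at t within {0..} = bot")
    case False
    show ?thesis
    proof (rule tendsto_if_coeffs_tendsto)
      \<comment> \<open>On times below t + 1 all multipliers are at most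
        \<open>exp (\<omega> * (t + 1))\<close>, which yields a dominating sequence independent of
        t'.\<close>
      have ev: "\<forall>\<^sub>F t' in at t within {0..}. 0 \<le> t' \<and> t' < t + 1"
        unfolding eventually_at by (rule exI[of _ 1]) (auto simp: dist_real_def)
      show "((\<lambda>t'. inner (sg t' u) (e n)) \<longlongrightarrow> inner (sg t u) (e n)) (at t within {0..})" for n
      proof (rule Lim_transform_eventually)
        show "((\<lambda>t'. exp (lam n * t') * inner u (e n)) \<longlongrightarrow> inner (sg t u) (e n)) (at t within {0..})"
          using t by (auto simp: inner_sg intro!: tendsto_intros)
        show "\<forall>\<^sub>F t' in at t within {0..}. exp (lam n * t') * inner u (e n) = inner (sg t' u) (e n)"
          using ev by eventually_elim (simp add: inner_sg)
      qed
      show "\<forall>\<^sub>F t' in at t within {0..}. \<forall>n. \<bar>inner (sg t' u) (e n) - inner (sg t u) (e n)\<bar>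
          \<le> (exp (\<omega> * (t + 1)) * 2) * \<bar>inner u (e n)\<bar>"
        using ev
      proof eventually_elim
        case (elim t')
        have b: "exp (lam n * t'') \<le> exp (\<omega> * (t + 1))" if "0 \<le> t''" "t'' \<le> t + 1" for n t''
          using exp_le[OF that(1), of n] mult_left_mono[OF that(2) \<omega>_nonneg]
          by (auto intro: order_trans)
        have "\<bar>exp (lam n * t') - exp (lam n * t)\<bar> \<le> exp (\<omega> * (t + 1)) * 2" for n
        proof -
          have "\<bar>x - y\<bar> \<le> B * 2" if "0 < x" "x \<le> B" "0 < y" "y \<le> B" for x y B :: real
            using that by linarith
          then show ?thesis
            using b[of t' n] b[of t n] elim t by simp
        qed
        then show ?case
          using elim t by (auto simp: inner_sg abs_mult simp flip: left_diff_distrib intro!: mult_right_mono)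
      qed
      show "summable (\<lambda>n. ((exp (\<omega> * (t + 1)) * 2) * \<bar>inner u (e n)\<bar>)\<^sup>2)"
        unfolding power_mult_distrib by (simp add: summable_coeffs)
    qed (rule False)
  qed simp
qed

lemma C0_semigroup: "C0_semigroup semigroup"
  unfolding C0_semigroup_def
proof (intro conjI allI impI)
  show "semigroup 0 = id_blinfun"
    by (rule blinfun_eqI, rule eq_if_coeffs_eq) (simp add: semigroup_apply inner_sg)
  show "semigroup (t + t') = semigroup t o\<^sub>L semigroup t'" if "0 \<le> t" "0 \<le> t'" for t t'
    using that
    by (intro blinfun_eqI eq_if_coeffs_eq)
       (simp add: semigroup_apply inner_sg distrib_left exp_add)
  show "((\<lambda>t. blinfun_apply (semigroup t) u) \<longlongrightarrow> u) (at_right 0)" for u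
  proof (rule Lim_transform_eventually)
    have "sg 0 u = u"
      by (rule eq_if_coeffs_eq) (simp add: inner_sg)
    then have "((\<lambda>t. sg t u) \<longlongrightarrow> u) (at 0 within {0..})"
      using continuous_sg[of u] unfolding continuous_on_def by force
    then show "((\<lambda>t. sg t u) \<longlongrightarrow> u) (at_right 0)"
      by (rule tendsto_within_subset) auto
    show "\<forall>\<^sub>F t in at_right 0. sg t u = blinfun_apply (semigroup t) u"
      using eventually_at_right_less[of 0] by eventually_elim (simp add: semigroup_apply)
  qed
qed

text \<open>Supplies the dominating sequence for difference quotients, uniformly in n although
  \<open>lam n\<close> is unbounded below. It comes from |exp x - 1| \<le> exp y * |x| for x \<le> y
  and y \<ge> 0, applied with x = lam n * t and y = \<omega>.\<close>

lemma abs_exp_quotient_le: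
  assumes "0 < t" "t < 1"
  shows "\<bar>(exp (lam n * t) - 1) / t\<bar> \<le> exp \<omega> * \<bar>lam n\<bar>"
proof -
  have "\<bar>exp x - 1\<bar> \<le> exp y * \<bar>x\<bar>" if "x \<le> y" "0 \<le> y" for x y :: real
  proof (cases "0 \<le> x")
    case True
    have "1 - x \<le> exp (- x)" using exp_ge_add_one_self[of "- x"] by simp
    then have "exp x * (1 - x) \<le> exp x * exp (- x)" by (rule mult_left_mono) simp
    also have "exp x * exp (- x) = 1" by (simp flip: exp_add)
    finally have "exp x * (1 - x) \<le> 1" .
    then have "exp x - 1 \<le> exp x * x" by (simp add: algebra_simps)
    also have "\<dots> \<le> exp y * x" using that True by (intro mult_right_mono) auto
    finally show ?thesis using True by simp
  next
    case False
    have "1 - exp x \<le> - x" using exp_ge_add_one_self[of x] by linarith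
    also have "\<dots> \<le> exp y * (- x)"
      using mult_right_mono[of 1 "exp y" "- x"] that False by simp
    finally show ?thesis using False by simp
  qed
  moreover have "lam n * t \<le> \<omega>"
    using mult_right_mono[OF lam_le[of n], of t] mult_left_mono[OF _ \<omega>_nonneg, of t 1] assms by linarith
  ultimately have "\<bar>exp (lam n * t) - 1\<bar> \<le> exp \<omega> * \<bar>lam n * t\<bar>"
    using \<omega>_nonneg by blast
  then show ?thesis
    using assms by (simp add: abs_mult divide_le_eq mult.assoc)
qed

lemma exp_quotient_tendsto: "((\<lambda>t. (exp (x * t) - 1) / t) \<longlongrightarrow> x) (at_right (0::real))" for x :: real
proof -
  have "((\<lambda>t. exp (x * t)) has_real_derivative x) (at 0 within {0<..})"
    by (auto intro!: derivative_eq_intros)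
  then show ?thesis by (simp add: has_field_derivative_iff)
qed

text \<open>Each coefficient of the difference quotient converges to
  \<open>lam n * inner u (e n)\<close>, whether or not u is in \<open>dom\<close>. Norm convergence
  to y therefore forces these to be the coefficients of y, and Bessel makes them square summable;
  conversely square summability gives the dominating sequence for norm convergence.\<close>

lemma generator_iff:
  "((\<lambda>t. (blinfun_apply (semigroup t) u - u) /\<^sub>R t) \<longlongrightarrow> y) (at_right 0) \<longleftrightarrow> u \<in> dom \<and> y = gen u"
proof -
  let ?c = "\<lambda>n. inner u (e n)"
  have ev: "\<forall>\<^sub>F t in at_right 0. 0 < t \<and> t < (1::real)"
    unfolding eventually_at by (rule exI[of _ 1]) (auto simp: dist_real_def)
  have co: "inner ((blinfun_apply (semigroup t) u - u) /\<^sub>R t) (e n) = (exp (lam n * t) - 1) / t * ?c n"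
    if "0 < t" for t n
    using that by (simp add: semigroup_apply inner_sg inner_diff_left field_simps)
  have lim: "((\<lambda>t. inner ((blinfun_apply (semigroup t) u - u) /\<^sub>R t) (e n)) \<longlongrightarrow> lam n * ?c n) (at_right 0)" for n
  proof (rule Lim_transform_eventually)
    show "((\<lambda>t. (exp (lam n * t) - 1) / t * ?c n) \<longlongrightarrow> lam n * ?c n) (at_right 0)"
      by (intro tendsto_mult_right exp_quotient_tendsto)
    show "\<forall>\<^sub>F t in at_right 0. (exp (lam n * t) - 1) / t * ?c n
        = inner ((blinfun_apply (semigroup t) u - u) /\<^sub>R t) (e n)"
      using ev by eventually_elim (simp only: co)
  qed
  show ?thesis
  proof safe
    assume y: "((\<lambda>t. (blinfun_apply (semigroup t) u - u) /\<^sub>R t) \<longlongrightarrow> y) (at_right 0)"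
    have yc: "inner y (e n) = lam n * ?c n" for n
      using tendsto_unique[OF _ tendsto_inner[OF y tendsto_const[of "e n"]] lim[of n]]
      by (simp add: trivial_limit_at_right_real)
    have "summable (\<lambda>n. (lam n * ?c n)\<^sup>2)"
      using summable_coeffs[of y] by (simp add: yc)
    then show "u \<in> dom" by (simp add: dom_def)
    show "y = gen u"
      using series_coeffs[of y] by (simp add: gen_def yc)
  next
    assume u: "u \<in> dom"
    then have su: "summable (\<lambda>n. (lam n * ?c n)\<^sup>2)" by (simp add: dom_def)
    have gc: "inner (gen u) (e n) = lam n * ?c n" for n
      unfolding gen_def by (rule inner_series[OF su])
    show "((\<lambda>t. (blinfun_apply (semigroup t) u - u) /\<^sub>R t) \<longlongrightarrow> gen u) (at_right 0)"
    proof (rule tendsto_if_coeffs_tendsto)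
      show "\<forall>\<^sub>F t in at_right 0. \<forall>n. \<bar>inner ((blinfun_apply (semigroup t) u - u) /\<^sub>R t) (e n) - inner (gen u) (e n)\<bar>
          \<le> (exp \<omega> + 1) * \<bar>lam n * ?c n\<bar>"
        using ev
      proof eventually_elim
        case (elim t)
        show ?case
        proof
          fix n
          have "\<bar>(exp (lam n * t) - 1) / t * ?c n - lam n * ?c n\<bar>
              \<le> \<bar>(exp (lam n * t) - 1) / t\<bar> * \<bar>?c n\<bar> + \<bar>lam n * ?c n\<bar>"
            by (metis abs_mult abs_triangle_ineq4)
          also have "\<dots> \<le> (exp \<omega> * \<bar>lam n\<bar>) * \<bar>?c n\<bar> + \<bar>lam n * ?c n\<bar>"
            using elim by (intro add_right_mono mult_right_mono abs_exp_quotient_le) auto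
          also have "\<dots> = (exp \<omega> + 1) * \<bar>lam n * ?c n\<bar>"
            by (simp add: abs_mult algebra_simps)
          finally show "\<bar>inner ((blinfun_apply (semigroup t) u - u) /\<^sub>R t) (e n) - inner (gen u) (e n)\<bar>
              \<le> (exp \<omega> + 1) * \<bar>lam n * ?c n\<bar>"
            using elim by (simp only: co gc)
        qed
      qed
      show "summable (\<lambda>n. ((exp \<omega> + 1) * \<bar>lam n * ?c n\<bar>)\<^sup>2)"
        using summable_mult[OF su, of "(exp \<omega> + 1)\<^sup>2"] by (simp add: power_mult_distrib)
    qed (use lim in \<open>simp_all add: gc trivial_limit_at_right_real\<close>)
  qed
qed

end

section \<open>Triangular perturbation and similarity of semigroups\<close>

lemma continuous_on_nonneg_at_zero:
  fixes f :: "real \<Rightarrow> 'a::real_normed_vector"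
  assumes "continuous_on {0..} f" "0 < \<epsilon>"
  shows "\<exists>\<delta>>0. \<forall>t\<ge>0. t < \<delta> \<longrightarrow> norm (f t - f 0) < \<epsilon>"
proof -
  obtain \<delta> where "0 < \<delta>" "\<And>t. t \<in> {0..} \<Longrightarrow> dist t 0 < \<delta> \<Longrightarrow> dist (f t) (f 0) < \<epsilon>"
    using assms unfolding continuous_on_iff by (meson atLeast_iff order_refl)
  then show ?thesis
    by (auto simp: dist_norm intro!: exI[of _ \<delta>])
qed

locale semigroup_pair =
  fixes T1 :: "real \<Rightarrow> 'a::banach \<Rightarrow>\<^sub>L 'a" and T2 :: "real \<Rightarrow> 'b::banach \<Rightarrow>\<^sub>L 'b"
    and B :: "'b \<Rightarrow>\<^sub>L 'a" and \<omega> :: real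
  assumes semigroup1: "C0_semigroup T1" and semigroup2: "C0_semigroup T2"
    and cont1: "continuous_on {0..} (\<lambda>t. T1 t x)" and cont2: "continuous_on {0..} (\<lambda>t. T2 t y)"
    and norm1: "0 \<le> t \<Longrightarrow> norm (T1 t) \<le> exp (\<omega> * t)"
    and norm2: "0 \<le> t \<Longrightarrow> norm (T2 t) \<le> exp (\<omega> * t)"
    and \<omega>_nonneg: "0 \<le> \<omega>"
begin

text \<open>The mild solution at time t of x' = A1 x + B (T2 t y) with x(0) = 0, where A1 generates
  \<open>T1\<close>.\<close>

definition duhamel :: "real \<Rightarrow> 'b \<Rightarrow> 'a" where
  "duhamel t y = integral {0..t} (\<lambda>\<tau>. T1 (t - \<tau>) (B (T2 \<tau> y)))"

definition triangular :: "real \<Rightarrow> ('a \<times> 'b) \<Rightarrow>\<^sub>L ('a \<times> 'b)" where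
  "triangular t = (if 0 \<le> t then Blinfun (\<lambda>p. (T1 t (fst p) + duhamel t (snd p), T2 t (snd p))) else 0)"

lemma norm1_apply_le:
  assumes "0 \<le> t" "t \<le> t'"
  shows "norm (T1 t x) \<le> exp (\<omega> * t') * norm x"
proof -
  have "norm (T1 t) \<le> exp (\<omega> * t')"
    using norm1[OF assms(1)] mult_left_mono[OF assms(2) \<omega>_nonneg] by (meson exp_le_cancel_iff order_trans)
  then show ?thesis
    using norm_blinfun[of "T1 t" x] by (meson mult_right_mono norm_ge_zero order_trans)
qed

lemma norm2_apply_le:
  assumes "0 \<le> t" "t \<le> t'"
  shows "norm (T2 t y) \<le> exp (\<omega> * t') * norm y"
proof -
  have "norm (T2 t) \<le> exp (\<omega> * t')"
    using norm2[OF assms(1)] mult_left_mono[OF assms(2) \<omega>_nonneg] by (meson exp_le_cancel_iff order_trans)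
  then show ?thesis
    using norm_blinfun[of "T2 t" y] by (meson mult_right_mono norm_ge_zero order_trans)
qed

text \<open>Both the operator and its argument move, and \<open>T1\<close> is only strongly
  continuous. The increment is split: with the argument frozen strong continuity applies, and the
  change of the argument is controlled by the uniform norm bound on [0, t].\<close>

lemma continuous_integrand: "continuous_on {0..t} (\<lambda>\<tau>. T1 (t - \<tau>) (B (T2 \<tau> y)))"
  unfolding continuous_on_def
proof
  fix \<tau> assume \<tau>: "\<tau> \<in> {0..t}"
  let ?F = "at \<tau> within {0..t}" and ?h = "\<lambda>\<tau>. B (T2 \<tau> y)"
  have h: "continuous_on {0..t} ?h"
    by (intro continuous_intros continuous_on_subset[OF cont2]) auto
  have "continuous_on {0..t} (\<lambda>\<sigma>. T1 (t - \<sigma>) (?h \<tau>))"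
    by (rule continuous_on_compose2[OF cont1]) (auto intro!: continuous_intros)
  then have 1: "((\<lambda>\<sigma>. T1 (t - \<sigma>) (?h \<tau>)) \<longlongrightarrow> T1 (t - \<tau>) (?h \<tau>)) ?F"
    using \<tau> by (simp add: continuous_on_def)
  have "((\<lambda>\<sigma>. exp (\<omega> * t) * norm (?h \<sigma> - ?h \<tau>)) \<longlongrightarrow> exp (\<omega> * t) * norm (?h \<tau> - ?h \<tau>)) ?F"
    using h \<tau> unfolding continuous_on_def
    by (intro tendsto_mult_left tendsto_norm tendsto_diff tendsto_const) auto
  then have 2: "((\<lambda>\<sigma>. exp (\<omega> * t) * norm (?h \<sigma> - ?h \<tau>)) \<longlongrightarrow> 0) ?F" by simp
  have "((\<lambda>\<sigma>. T1 (t - \<sigma>) (?h \<sigma> - ?h \<tau>)) \<longlongrightarrow> 0) ?F"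
  proof (rule Lim_null_comparison[OF _ 2])
    have "\<forall>\<^sub>F \<sigma> in ?F. \<sigma> \<in> {0..t}"
      by (simp add: eventually_at_filter)
    then show "\<forall>\<^sub>F \<sigma> in ?F. norm (T1 (t - \<sigma>) (?h \<sigma> - ?h \<tau>)) \<le> exp (\<omega> * t) * norm (?h \<sigma> - ?h \<tau>)"
      by eventually_elim (auto intro: norm1_apply_le)
  qed
  from tendsto_add[OF this 1]
  show "((\<lambda>\<sigma>. T1 (t - \<sigma>) (?h \<sigma>)) \<longlongrightarrow> T1 (t - \<tau>) (?h \<tau>)) ?F"
    by (simp add: blinfun.diff_right)
qed

lemma norm_duhamel_le:
  assumes "0 \<le> t"
  shows "norm (duhamel t y) \<le> norm y * (exp (\<omega> * t) * (norm B * exp (\<omega> * t)) * t)"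
proof -
  have "norm (duhamel t y) \<le> exp (\<omega> * t) * (norm B * (exp (\<omega> * t) * norm y)) * (t - 0)"
    unfolding duhamel_def
  proof (rule integral_bound[OF assms continuous_integrand])
    fix \<tau> assume \<tau>: "\<tau> \<in> {0..t}"
    have "norm (T1 (t - \<tau>) (B (T2 \<tau> y))) \<le> exp (\<omega> * t) * norm (B (T2 \<tau> y))"
      using \<tau> by (intro norm1_apply_le) auto
    also have "\<dots> \<le> exp (\<omega> * t) * (norm B * norm (T2 \<tau> y))"
      by (intro mult_left_mono norm_blinfun) auto
    also have "\<dots> \<le> exp (\<omega> * t) * (norm B * (exp (\<omega> * t) * norm y))"
      using \<tau> by (intro mult_left_mono norm2_apply_le) auto
    finally show "norm (T1 (t - \<tau>) (B (T2 \<tau> y))) \<le> exp (\<omega> * t) * (norm B * (exp (\<omega> * t) * norm y))" .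
  qed
  then show ?thesis by (simp add: mult_ac)
qed

lemma bounded_linear_duhamel:
  assumes "0 \<le> t"
  shows "bounded_linear (duhamel t)"
proof (rule bounded_linear_intro)
  have i: "(\<lambda>\<tau>. T1 (t - \<tau>) (B (T2 \<tau> y))) integrable_on {0..t}" for y
    by (rule integrable_continuous_interval[OF continuous_integrand])
  show "duhamel t (x + y) = duhamel t x + duhamel t y" for x y
    by (simp add: duhamel_def blinfun.add_right integral_add i)
  show "duhamel t (c *\<^sub>R x) = c *\<^sub>R duhamel t x" for c x
    by (simp add: duhamel_def blinfun.scaleR_right)
qed (rule norm_duhamel_le[OF assms])

lemma triangular_apply:
  assumes "0 \<le> t"
  shows "triangular t p = (T1 t (fst p) + duhamel t (snd p), T2 t (snd p))"
proof -
  have "bounded_linear (\<lambda>p. (T1 t (fst p) + duhamel t (snd p), T2 t (snd p)))"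
    by (intro bounded_linear_Pair bounded_linear_add
        bounded_linear_compose[OF bounded_linear_duhamel[OF assms]]
        bounded_linear_compose[OF blinfun.bounded_linear_right]
        bounded_linear_fst bounded_linear_snd)
  then show ?thesis
    using assms by (simp add: triangular_def bounded_linear_Blinfun_apply)
qed

lemma semigroup1_add: "0 \<le> t \<Longrightarrow> 0 \<le> t' \<Longrightarrow> T1 (t + t') x = T1 t (T1 t' x)"
  using semigroup1 by (simp add: C0_semigroup_def)

lemma semigroup2_add: "0 \<le> t \<Longrightarrow> 0 \<le> t' \<Longrightarrow> T2 (t + t') x = T2 t (T2 t' x)"
  using semigroup2 by (simp add: C0_semigroup_def)

text \<open>The cocycle identity that makes \<open>triangular\<close> multiplicative. The integral
  is cut at t': before the cut \<open>T1 t\<close> factors out, after it a shift by t' restarts the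
  integral from \<open>T2 t' y\<close>.\<close>

lemma duhamel_add:
  assumes "0 \<le> t" "0 \<le> t'"
  shows "duhamel (t + t') y = T1 t (duhamel t' y) + duhamel t (T2 t' y)"
proof -
  let ?f = "\<lambda>\<tau>. T1 (t + t' - \<tau>) (B (T2 \<tau> y))"
  have "duhamel (t + t') y = integral {0..t'} ?f + integral {t'..t + t'} ?f"
    unfolding duhamel_def using assms
    by (intro Henstock_Kurzweil_Integration.integral_combine[symmetric]
        integrable_continuous_interval continuous_integrand) auto
  also have "integral {0..t'} ?f = integral {0..t'} (blinfun_apply (T1 t) \<circ> (\<lambda>\<tau>. T1 (t' - \<tau>) (B (T2 \<tau> y))))"
    using assms by (intro integral_cong) (simp flip: semigroup1_add add: add_diff_eq)
  also have "\<dots> = T1 t (duhamel t' y)"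
    unfolding duhamel_def
    by (intro integral_linear integrable_continuous_interval continuous_integrand blinfun.bounded_linear_right)
  also have "integral {t'..t + t'} ?f = integral {0..t} (?f \<circ> (\<lambda>\<tau>. \<tau> + t'))"
    using integral_shift_Icc_real[of 0 t ?f t'] by (simp add: o_def add.commute)
  also have "\<dots> = duhamel t (T2 t' y)"
    unfolding duhamel_def using assms
    by (intro integral_cong) (simp add: semigroup2_add)
  finally show ?thesis .
qed

text \<open>The quotient is the mean over [0, t] of an integrand that tends to \<open>B y\<close>
  uniformly as t decreases to 0. The limit exists for every y, without any domain condition.\<close>

lemma duhamel_quotient_tendsto: "((\<lambda>t. duhamel t y /\<^sub>R t) \<longlongrightarrow> B y) (at_right 0)"
proof (rule tendstoI)
  fix \<epsilon> :: real assume \<epsilon>: "0 < \<epsilon>"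
  \<comment> \<open>The integrand errs by at most exp \<omega> * \<eta> from moving the argument of
    \<open>T1\<close> to \<open>B y\<close>, plus \<eta> from replacing \<open>T1\<close> by the
    identity.\<close>
  define \<eta> where "\<eta> = \<epsilon> / 2 / (exp \<omega> + 1)"
  have K: "0 < exp \<omega> + (1::real)" by (simp add: add_pos_pos)
  then have "(exp \<omega> + 1) * \<eta> = \<epsilon> / 2"
    unfolding \<eta>_def by (subst times_divide_eq_right, intro nonzero_mult_div_cancel_left) simp
  moreover have "0 < \<eta>"
    using K \<epsilon> by (simp add: \<eta>_def)
  ultimately have \<eta>: "0 < \<eta>" "(exp \<omega> + 1) * \<eta> < \<epsilon>"
    using \<epsilon> by linarith+
  have "continuous_on {0..} (\<lambda>t. B (T2 t y))"
    by (intro continuous_intros cont2)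
  then have "\<exists>\<delta>>0. \<forall>\<tau>\<ge>0. \<tau> < \<delta> \<longrightarrow> norm (B (T2 \<tau> y) - B (T2 0 y)) < \<eta>"
    using \<eta>(1) by (rule continuous_on_nonneg_at_zero)
  then obtain \<delta>2 where \<delta>2: "0 < \<delta>2" "\<And>\<tau>. 0 \<le> \<tau> \<Longrightarrow> \<tau> < \<delta>2 \<Longrightarrow> norm (B (T2 \<tau> y) - B y) < \<eta>"
    using semigroup2 by (auto simp: C0_semigroup_def)
  have "\<exists>\<delta>>0. \<forall>\<tau>\<ge>0. \<tau> < \<delta> \<longrightarrow> norm (T1 \<tau> (B y) - T1 0 (B y)) < \<eta>"
    using cont1[of "B y"] \<eta>(1) by (rule continuous_on_nonneg_at_zero)
  then obtain \<delta>1 where \<delta>1: "0 < \<delta>1" "\<And>\<tau>. 0 \<le> \<tau> \<Longrightarrow> \<tau> < \<delta>1 \<Longrightarrow> norm (T1 \<tau> (B y) - B y) < \<eta>"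
    using semigroup1 by (auto simp: C0_semigroup_def)
  have "dist (duhamel t y /\<^sub>R t) (B y) < \<epsilon>" if t: "0 < t" "t < min 1 (min \<delta>1 \<delta>2)" for t
  proof -
    let ?f = "\<lambda>\<tau>. T1 (t - \<tau>) (B (T2 \<tau> y))"
    have "norm (integral {0..t} (\<lambda>\<tau>. ?f \<tau> - B y)) \<le> (exp \<omega> + 1) * \<eta> * (t - 0)"
    proof (rule integral_bound)
      show "continuous_on {0..t} (\<lambda>\<tau>. ?f \<tau> - B y)"
        by (intro continuous_intros continuous_integrand)
      fix \<tau> assume \<tau>: "\<tau> \<in> {0..t}"
      have "norm (?f \<tau> - B y) = norm (T1 (t - \<tau>) (B (T2 \<tau> y) - B y) + (T1 (t - \<tau>) (B y) - B y))"
        by (simp add: blinfun.diff_right)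
      also have "\<dots> \<le> norm (T1 (t - \<tau>) (B (T2 \<tau> y) - B y)) + norm (T1 (t - \<tau>) (B y) - B y)"
        by (rule norm_triangle_ineq)
      also have "\<dots> \<le> exp (\<omega> * 1) * norm (B (T2 \<tau> y) - B y) + \<eta>"
        using \<tau> t by (intro add_mono norm1_apply_le less_imp_le[OF \<delta>1(2)]) auto
      also have "\<dots> \<le> exp (\<omega> * 1) * \<eta> + \<eta>"
        using \<tau> t by (intro add_mono mult_left_mono less_imp_le[OF \<delta>2(2)]) auto
      finally show "norm (?f \<tau> - B y) \<le> (exp \<omega> + 1) * \<eta>"
        by (simp add: distrib_right)
    qed (use t in simp)
    moreover have "integral {0..t} (\<lambda>\<tau>. ?f \<tau> - B y) = duhamel t y - t *\<^sub>R B y"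
      using t unfolding duhamel_def
      by (subst integral_diff) (auto intro: integrable_continuous_interval continuous_integrand)
    ultimately have *: "norm (duhamel t y - t *\<^sub>R B y) \<le> (exp \<omega> + 1) * \<eta> * t" by simp
    have "duhamel t y /\<^sub>R t - B y = (duhamel t y - t *\<^sub>R B y) /\<^sub>R t"
      using t by (simp add: scaleR_diff_right)
    then have "norm (duhamel t y /\<^sub>R t - B y) = norm (duhamel t y - t *\<^sub>R B y) / t"
      using t by (simp add: divide_inverse_commute)
    also have "\<dots> \<le> (exp \<omega> + 1) * \<eta>"
      using * t by (simp add: divide_le_eq)
    finally show ?thesis using \<eta>(2) by (simp add: dist_norm)
  qed
  then show "\<forall>\<^sub>F t in at_right 0. dist (duhamel t y /\<^sub>R t) (B y) < \<epsilon>"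
    unfolding eventually_at using \<delta>1(1) \<delta>2(1)
    by (intro exI[of _ "min 1 (min \<delta>1 \<delta>2)"]) (auto simp: dist_real_def)
qed

lemma C0_semigroup_triangular: "C0_semigroup triangular"
  unfolding C0_semigroup_def
proof (intro conjI allI impI)
  show "triangular 0 = id_blinfun"
  proof (rule blinfun_eqI)
    show "triangular 0 p = id_blinfun p" for p
      using semigroup1 semigroup2 by (simp add: triangular_apply duhamel_def C0_semigroup_def)
  qed
  show "triangular (t + t') = triangular t o\<^sub>L triangular t'" if "0 \<le> t" "0 \<le> t'" for t t'
  proof (rule blinfun_eqI)
    show "triangular (t + t') p = (triangular t o\<^sub>L triangular t') p" for p
      using that
      by (simp add: triangular_apply semigroup1_add semigroup2_add duhamel_add blinfun.add_right)
  qed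
  show "((\<lambda>t. triangular t p) \<longlongrightarrow> p) (at_right 0)" for p
  proof (rule Lim_transform_eventually)
    \<comment> \<open>A convergent difference quotient, multiplied back by t, shows that
      \<open>duhamel\<close> itself vanishes at time 0.\<close>
    have "((\<lambda>t. t *\<^sub>R (duhamel t (snd p) /\<^sub>R t)) \<longlongrightarrow> 0 *\<^sub>R B (snd p)) (at_right 0)"
      by (intro tendsto_intros duhamel_quotient_tendsto)
    moreover have "\<forall>\<^sub>F t in at_right 0. t *\<^sub>R (duhamel t (snd p) /\<^sub>R t) = duhamel t (snd p)"
      using eventually_at_right_less[of "0::real"] by eventually_elim simp
    ultimately have d: "((\<lambda>t. duhamel t (snd p)) \<longlongrightarrow> 0) (at_right 0)"
      using Lim_transform_eventually by force
    have "((\<lambda>t. (T1 t (fst p) + duhamel t (snd p), T2 t (snd p))) \<longlongrightarrow> (fst p + 0, snd p)) (at_right 0)"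
      using semigroup1 semigroup2 d by (intro tendsto_intros) (auto simp: C0_semigroup_def)
    then show "((\<lambda>t. (T1 t (fst p) + duhamel t (snd p), T2 t (snd p))) \<longlongrightarrow> p) (at_right 0)"
      by simp
    show "\<forall>\<^sub>F t in at_right 0. (T1 t (fst p) + duhamel t (snd p), T2 t (snd p)) = triangular t p"
      using eventually_at_right_less[of "0::real"] by eventually_elim (simp add: triangular_apply)
  qed
qed

text \<open>Because the Duhamel quotient always converges to \<open>B (snd p)\<close>, it can be
  subtracted or added in the limit. So the perturbation leaves the domain unchanged and adds B to
  the action.\<close>

lemma generator_triangular_iff:
  assumes gen1: "\<And>x y. ((\<lambda>t. (T1 t x - x) /\<^sub>R t) \<longlongrightarrow> y) (at_right 0) \<longleftrightarrow> x \<in> D1 \<and> y = A1 x"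
    and gen2: "\<And>x y. ((\<lambda>t. (T2 t x - x) /\<^sub>R t) \<longlongrightarrow> y) (at_right 0) \<longleftrightarrow> x \<in> D2 \<and> y = A2 x"
  shows "((\<lambda>t. (triangular t p - p) /\<^sub>R t) \<longlongrightarrow> q) (at_right 0) \<longleftrightarrow>
    p \<in> D1 \<times> D2 \<and> q = (A1 (fst p) + B (snd p), A2 (snd p))"
proof -
  let ?x = "fst p" and ?y = "snd p"
  have "((\<lambda>t. (triangular t p - p) /\<^sub>R t) \<longlongrightarrow> q) (at_right 0) \<longleftrightarrow>
      ((\<lambda>t. ((T1 t ?x - ?x) /\<^sub>R t + duhamel t ?y /\<^sub>R t, (T2 t ?y - ?y) /\<^sub>R t)) \<longlongrightarrow> q) (at_right 0)"
  proof (rule filterlim_cong[OF refl refl])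
    show "\<forall>\<^sub>F t in at_right 0. (triangular t p - p) /\<^sub>R t =
        ((T1 t ?x - ?x) /\<^sub>R t + duhamel t ?y /\<^sub>R t, (T2 t ?y - ?y) /\<^sub>R t)"
      using eventually_at_right_less[of "0::real"]
      by eventually_elim (auto simp: triangular_apply prod_eq_iff algebra_simps)
  qed
  also have "\<dots> \<longleftrightarrow> ((\<lambda>t. (T1 t ?x - ?x) /\<^sub>R t) \<longlongrightarrow> fst q - B ?y) (at_right 0) \<and>
      ((\<lambda>t. (T2 t ?y - ?y) /\<^sub>R t) \<longlongrightarrow> snd q) (at_right 0)"
  proof safe
    assume q: "((\<lambda>t. ((T1 t ?x - ?x) /\<^sub>R t + duhamel t ?y /\<^sub>R t, (T2 t ?y - ?y) /\<^sub>R t)) \<longlongrightarrow> q) (at_right 0)"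
    show "((\<lambda>t. (T1 t ?x - ?x) /\<^sub>R t) \<longlongrightarrow> fst q - B ?y) (at_right 0)"
      using tendsto_diff[OF tendsto_fst[OF q] duhamel_quotient_tendsto[of ?y]] by simp
    show "((\<lambda>t. (T2 t ?y - ?y) /\<^sub>R t) \<longlongrightarrow> snd q) (at_right 0)"
      using tendsto_snd[OF q] by simp
  next
    assume 1: "((\<lambda>t. (T1 t ?x - ?x) /\<^sub>R t) \<longlongrightarrow> fst q - B ?y) (at_right 0)"
      and 2: "((\<lambda>t. (T2 t ?y - ?y) /\<^sub>R t) \<longlongrightarrow> snd q) (at_right 0)"
    show "((\<lambda>t. ((T1 t ?x - ?x) /\<^sub>R t + duhamel t ?y /\<^sub>R t, (T2 t ?y - ?y) /\<^sub>R t)) \<longlongrightarrow> q) (at_right 0)"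
      using tendsto_Pair[OF tendsto_add[OF 1 duhamel_quotient_tendsto[of ?y]] 2] by simp
  qed
  also have "\<dots> \<longleftrightarrow> p \<in> D1 \<times> D2 \<and> q = (A1 ?x + B ?y, A2 ?y)"
    unfolding gen1 gen2 by (auto simp: prod_eq_iff mem_Times_iff algebra_simps)
  finally show ?thesis .
qed

end

text \<open>Linear P and Q map difference quotients to difference quotients, and their continuity
  transports limits in both directions, so the domain is characterized exactly.\<close>

lemma generates_C0_semigroup_similar:
  fixes P :: "'a::banach \<Rightarrow>\<^sub>L 'b::banach" and Q :: "'b \<Rightarrow>\<^sub>L 'a"
  assumes gen: "generates_C0_semigroup D A"
    and QP: "\<And>x. Q (P x) = x" and PQ: "\<And>y. P (Q y) = y"
  shows "generates_C0_semigroup {x. P x \<in> D} (\<lambda>x. Q (A (P x)))"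
proof -
  obtain T where T: "C0_semigroup T"
    and iff: "\<And>x y. ((\<lambda>t. (blinfun_apply (T t) x - x) /\<^sub>R t) \<longlongrightarrow> y) (at_right 0) \<longleftrightarrow> x \<in> D \<and> y = A x"
    using gen unfolding generates_C0_semigroup_def by blast
  define S where "S t = Q o\<^sub>L T t o\<^sub>L P" for t
  have "C0_semigroup S"
    unfolding C0_semigroup_def
  proof (intro conjI allI impI)
    show "S 0 = id_blinfun"
      using T by (intro blinfun_eqI) (simp add: S_def C0_semigroup_def QP)
    show "S (t + t') = S t o\<^sub>L S t'" if "0 \<le> t" "0 \<le> t'" for t t'
      using T that by (intro blinfun_eqI) (simp add: S_def C0_semigroup_def PQ)
    show "((\<lambda>t. S t x) \<longlongrightarrow> x) (at_right 0)" for x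
    proof -
      have "((\<lambda>t. Q (T t (P x))) \<longlongrightarrow> Q (P x)) (at_right 0)"
        using T by (intro blinfun.tendsto tendsto_const) (simp add: C0_semigroup_def)
      then show ?thesis by (simp add: S_def QP)
    qed
  qed
  moreover have "((\<lambda>t. (S t x - x) /\<^sub>R t) \<longlongrightarrow> y) (at_right 0) \<longleftrightarrow> x \<in> {x. P x \<in> D} \<and> y = Q (A (P x))" for x y
  proof -
    have "((\<lambda>t. (S t x - x) /\<^sub>R t) \<longlongrightarrow> y) (at_right 0) \<longleftrightarrow>
        ((\<lambda>t. (T t (P x) - P x) /\<^sub>R t) \<longlongrightarrow> P y) (at_right 0)"
    proof
      assume "((\<lambda>t. (S t x - x) /\<^sub>R t) \<longlongrightarrow> y) (at_right 0)"
      then have "((\<lambda>t. P ((S t x - x) /\<^sub>R t)) \<longlongrightarrow> P y) (at_right 0)"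
        by (intro blinfun.tendsto tendsto_const)
      then show "((\<lambda>t. (T t (P x) - P x) /\<^sub>R t) \<longlongrightarrow> P y) (at_right 0)"
        by (simp add: S_def blinfun.diff_right blinfun.scaleR_right PQ)
    next
      assume "((\<lambda>t. (T t (P x) - P x) /\<^sub>R t) \<longlongrightarrow> P y) (at_right 0)"
      then have "((\<lambda>t. Q ((T t (P x) - P x) /\<^sub>R t)) \<longlongrightarrow> Q (P y)) (at_right 0)"
        by (intro blinfun.tendsto tendsto_const)
      then show "((\<lambda>t. (S t x - x) /\<^sub>R t) \<longlongrightarrow> y) (at_right 0)"
        by (simp add: S_def blinfun.diff_right blinfun.scaleR_right QP)
    qed
    also have "\<dots> \<longleftrightarrow> P x \<in> D \<and> P y = A (P x)" by (rule iff)
    also have "\<dots> \<longleftrightarrow> x \<in> {x. P x \<in> D} \<and> y = Q (A (P x))"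
      using QP PQ by (metis mem_Collect_eq)
    finally show ?thesis .
  qed
  ultimately show ?thesis
    unfolding generates_C0_semigroup_def by blast
qed

section \<open>Compactly supported continuous functions are dense\<close>

abbreviation unit_measure :: "real measure" where
  "unit_measure \<equiv> lebesgue_on {0<..<1}"

lemma finite_unit_measure: "finite_measure unit_measure"
  by (rule finite_measureI) (simp add: emeasure_restrict_space)

lemma square_integrable_bounded:
  assumes "f \<in> borel_measurable unit_measure" and "\<And>x. \<bar>f x\<bar> \<le> C"
  shows "square_integrable f"
  unfolding square_integrable_def
proof
  show "integrable unit_measure (\<lambda>x. (f x)\<^sup>2)"
  proof (rule finite_measure.integrable_const_bound[OF finite_unit_measure, of _ "C\<^sup>2"])
    show "AE x in unit_measure. norm ((f x)\<^sup>2) \<le> C\<^sup>2"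
      using power_mono[OF assms(2) abs_ge_zero, of _ 2] by simp
  qed (use assms(1) in simp)
qed (rule assms(1))

lemma integrable_continuous_unit:
  fixes f :: "real \<Rightarrow> real"
  shows "continuous_on {0..1} f \<Longrightarrow> integrable unit_measure f"
  using l2_integrable_mult[of f "\<lambda>_. 1"] square_integrable_continuous[of f]
    square_integrable_continuous[of "\<lambda>_. 1"] by simp

lemma lebesgue_integral_unit:
  fixes f :: "real \<Rightarrow> real"
  assumes "integrable unit_measure f"
  shows "integral\<^sup>L unit_measure f = integral {0..1} f"
  using lebesgue_integral_eq_integral[OF assms] by (simp add: integral_open_interval_real)

lemma inner_continuous:
  assumes "continuous_on {0..1} f" "continuous_on {0..1} g"
  shows "inner (l2_of f) (l2_of g) = integral {0..1} (\<lambda>x. f x * g x)"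
  using assms
  by (simp add: inner_l2_of square_integrable_continuous lebesgue_integral_unit
      integrable_continuous_unit continuous_on_mult)

section \<open>Representatives, pointwise bounds and dominated convergence in L^2\<close>

lemma l2_of_add:
  assumes "square_integrable f" "square_integrable g"
  shows "l2_of (\<lambda>x. f x + g x) = l2_of f + l2_of g"
  using assms by transfer (simp add: l2_eq_def square_integrable_add)

lemma l2_of_cmult:
  assumes "square_integrable f"
  shows "l2_of (\<lambda>x. c * f x) = c *\<^sub>R l2_of f"
  using assms by transfer (simp add: l2_eq_def square_integrable_cmult)

lemma l2_of_zero: "l2_of (\<lambda>x. 0) = 0"
  by transfer (simp add: l2_eq_def square_integrable_zero)

lemma l2_of_not_square_integrable: "\<not> square_integrable f \<Longrightarrow> l2_of f = 0"
  by transfer (simp add: l2_eq_def square_integrable_zero)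

text \<open>Functions that agree on (0, 1) are square integrable together, so the default value 0 of
  \<open>l2_of\<close> is taken for both or for neither.\<close>

lemma l2_of_cong:
  assumes "\<And>x. x \<in> {0<..<1} \<Longrightarrow> f x = g x"
  shows "l2_of f = l2_of g"
proof -
  have "square_integrable f \<longleftrightarrow> square_integrable g"
    unfolding square_integrable_def
    by (intro conj_cong measurable_cong Bochner_Integration.integrable_cong refl) (auto simp: assms)
  then show ?thesis
    by (cases "square_integrable f")
       (auto simp: l2_of_eq_iff l2_of_not_square_integrable assms intro!: AE_I2)
qed

text \<open>The unit interval has measure 1. If f is not square integrable, \<open>l2_of f\<close>
  is the default 0, which 0 \<le> C covers.\<close>

lemma norm_l2_of_le:
  assumes "\<And>x. x \<in> {0<..<1} \<Longrightarrow> \<bar>f x\<bar> \<le> C" and "0 \<le> C"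
  shows "norm (l2_of f) \<le> C"
proof (cases "square_integrable f")
  case True
  have "(norm (l2_of f))\<^sup>2 \<le> integral\<^sup>L unit_measure (\<lambda>x. C\<^sup>2)"
    unfolding norm_l2_of[OF True]
  proof (rule integral_mono)
    show "integrable unit_measure (\<lambda>x. (f x)\<^sup>2)"
      using True by (simp add: square_integrable_def)
    show "integrable unit_measure (\<lambda>x. C\<^sup>2)"
      by (rule integrable_continuous_unit) simp
    show "(f x)\<^sup>2 \<le> C\<^sup>2" if "x \<in> space unit_measure" for x
      using power_mono[OF assms(1) abs_ge_zero, of x 2] that by simp
  qed
  then have "(norm (l2_of f))\<^sup>2 \<le> C\<^sup>2"
    by (simp add: measure_restrict_space)
  then show ?thesis
    using assms(2) by (rule power2_le_imp_le)
qed (simp add: l2_of_not_square_integrable assms)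

lemma l2_of_tendsto:
  assumes f: "\<And>k. square_integrable (f k)" and g: "square_integrable g" and w: "square_integrable w"
    and lim: "AE x in unit_measure. (\<lambda>k. f k x) \<longlonglongrightarrow> g x"
    and bound: "\<And>k x. \<bar>f k x - g x\<bar> \<le> w x"
  shows "(\<lambda>k. l2_of (f k)) \<longlonglongrightarrow> l2_of g"
proof -
  have [measurable]: "f k \<in> borel_measurable unit_measure" "g \<in> borel_measurable unit_measure" for k
    using f g by (auto intro: square_integrable_measurable)
  have "(\<lambda>k. integral\<^sup>L unit_measure (\<lambda>x. (f k x - g x)\<^sup>2)) \<longlonglongrightarrow> integral\<^sup>L unit_measure (\<lambda>x. 0)"
  proof (rule integral_dominated_convergence)
    show "integrable unit_measure (\<lambda>x. (w x)\<^sup>2)"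
      using w by (simp add: square_integrable_def)
    show "AE x in unit_measure. (\<lambda>k. (f k x - g x)\<^sup>2) \<longlonglongrightarrow> 0"
      using lim
    proof eventually_elim
      case (elim x)
      show ?case
        using tendsto_power[OF tendsto_diff[OF elim tendsto_const[of "g x"]], of 2] by simp
    qed
    show "AE x in unit_measure. norm ((f k x - g x)\<^sup>2) \<le> (w x)\<^sup>2" for k
      using power_mono[OF bound abs_ge_zero, of k _ 2] by simp
  qed measurable
  then have "(\<lambda>k. (norm (l2_of (f k) - l2_of g))\<^sup>2) \<longlonglongrightarrow> 0"
    using norm_l2_of[OF square_integrable_diff[OF f g]] by (simp add: l2_of_diff[OF f g])
  then have "(\<lambda>k. sqrt ((norm (l2_of (f k) - l2_of g))\<^sup>2)) \<longlonglongrightarrow> sqrt 0"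
    by (rule tendsto_real_sqrt)
  then have "(\<lambda>k. norm (l2_of (f k) - l2_of g)) \<longlonglongrightarrow> 0" by simp
  then show ?thesis
    by (rule LIM_zero_cancel[OF tendsto_norm_zero_cancel])
qed

text \<open>These functions serve twice: as a dense set for identities that are continuous in L^2,
  and as derivatives of test functions. For \<delta> > 1/2 the interval is empty and h = 0.\<close>

definition inner_supported :: "(real \<Rightarrow> real) set" where
  "inner_supported = {h. continuous_on UNIV h \<and> (\<exists>\<delta>>0. \<forall>x. x \<notin> {\<delta>..1 - \<delta>} \<longrightarrow> h x = 0)}"

lemma inner_supported_continuous: "h \<in> inner_supported \<Longrightarrow> continuous_on S h"
  by (auto simp: inner_supported_def intro: continuous_on_subset)

text \<open>A measurable function is an almost everywhere limit of continuous ones; clipping these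
  to [-C, C] and cutting them off near the ends keeps the limit and provides a constant dominating
  function.\<close>

lemma bounded_in_closure:
  assumes f: "f \<in> borel_measurable unit_measure" and C: "\<And>x. \<bar>f x\<bar> \<le> C"
  shows "l2_of f \<in> closure (l2_of ` inner_supported)"
proof -
  have C0: "0 \<le> C" using C[of 0] by linarith
  have "(\<lambda>x. if x \<in> {0<..<1} then f x else 0) \<in> borel_measurable lebesgue"
    by (rule borel_measurable_if_I[OF f]) simp
  then have "(\<lambda>x. if x \<in> {0<..<1} then f x else 0) measurable_on UNIV"
    by (rule lebesgue_measurable_imp_measurable_on_real) simp
  then obtain N g where N: "negligible N" and g: "\<And>n::nat. continuous_on UNIV (g n)"
    and lim: "\<And>x. x \<notin> N \<Longrightarrow> (\<lambda>n. g n x) \<longlonglongrightarrow> (if x \<in> {0<..<1} then f x else 0)"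
    unfolding measurable_on_def by auto
  \<comment> \<open>For n > 0 the cutoff is 0 within distance 1/n of the complement of (0, 1), rises
    linearly, and is 1 from distance 2/n on.\<close>
  define cut where "cut n x = max 0 (min 1 (real n * min x (1 - x) - 1))" for n x
  define h where "h n x = max (- C) (min C (g n x)) * cut n x" for n x
  have cut: "0 \<le> cut n x" "cut n x \<le> 1" for n x by (auto simp: cut_def)
  have h_bound: "\<bar>h n x\<bar> \<le> C" for n x
  proof -
    have "\<bar>max (- C) (min C (g n x))\<bar> * cut n x \<le> C * 1"
      by (rule mult_mono) (use cut C0 in auto)
    then show ?thesis using cut by (simp add: h_def abs_mult)
  qed
  have h_cont: "continuous_on UNIV (h n)" for n
    unfolding h_def cut_def by (intro continuous_intros g)
  \<comment> \<open>The margin 1/(n + 1) rather than 1/n is a positive real for n = 0 too.\<close>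
  have h_supp: "h n x = 0" if "x \<notin> {1 / (real n + 1)..1 - 1 / (real n + 1)}" for n x
  proof -
    have "min x (1 - x) < 1 / (real n + 1)" using that by auto
    then have "real n * min x (1 - x) \<le> 1"
    proof (cases "0 \<le> min x (1 - x)")
      case True
      have "min x (1 - x) * (real n + 1) < 1"
        using \<open>min x (1 - x) < 1 / (real n + 1)\<close> by (simp add: pos_less_divide_eq)
      moreover have "real n * min x (1 - x) \<le> (real n + 1) * min x (1 - x)"
        using True by (intro mult_right_mono) auto
      ultimately show ?thesis by (simp only: mult.commute)
    next
      case False
      then have "real n * min x (1 - x) \<le> 0" by (intro mult_nonneg_nonpos) auto
      then show ?thesis by linarith
    qed
    then show ?thesis by (simp add: h_def cut_def)
  qed
  have h_mem: "h n \<in> inner_supported" for n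
    unfolding inner_supported_def using h_cont h_supp
    by (auto intro!: exI[of _ "1 / (real n + 1)"])
  have "(\<lambda>n. l2_of (h n)) \<longlonglongrightarrow> l2_of f"
  proof (rule l2_of_tendsto)
    show "square_integrable (h n)" for n
      by (rule square_integrable_continuous[OF inner_supported_continuous[OF h_mem]])
    show "square_integrable f"
      by (rule square_integrable_bounded[OF f C])
    show "square_integrable (\<lambda>_. 2 * C)"
      by (rule square_integrable_continuous) simp
    show "\<bar>h n x - f x\<bar> \<le> 2 * C" for n x
      using h_bound[of n x] C[of x] by linarith
    have "AE x in lebesgue. x \<notin> N"
      using N by (auto simp: negligible_iff_null_sets intro: AE_not_in)
    then have "AE x in lebesgue. x \<in> {0<..<1} \<longrightarrow> x \<notin> N"
      by eventually_elim simp
    then have "AE x in unit_measure. x \<notin> N"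
      by (simp add: AE_restrict_space_iff)
    moreover have "AE x in unit_measure. x \<in> {0<..<1}"
      by (simp add: AE_restrict_space_iff)
    ultimately show "AE x in unit_measure. (\<lambda>n. h n x) \<longlonglongrightarrow> f x"
    proof eventually_elim
      case (elim x)
      then have "(\<lambda>n. g n x) \<longlonglongrightarrow> f x" using lim[of x] by simp
      then have "(\<lambda>n. max (- C) (min C (g n x))) \<longlonglongrightarrow> max (- C) (min C (f x))"
        by (intro tendsto_intros)
      also have "max (- C) (min C (f x)) = f x" using C[of x] by auto
      finally have 1: "(\<lambda>n. max (- C) (min C (g n x))) \<longlonglongrightarrow> f x" .
      have m: "0 < min x (1 - x)" using elim by auto
      obtain n0 where n0: "2 / min x (1 - x) < real n0"
        using reals_Archimedean2 by blast
      have "cut n x = 1" if "n \<ge> n0" for n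
      proof -
        have "2 < real n0 * min x (1 - x)" using n0 m by (simp add: pos_divide_less_eq)
        also have "\<dots> \<le> real n * min x (1 - x)" using that m by (intro mult_right_mono) auto
        finally show ?thesis by (simp add: cut_def)
      qed
      then have "\<forall>\<^sub>F n in sequentially. cut n x = 1"
        unfolding eventually_sequentially by blast
      then have 2: "(\<lambda>n. cut n x) \<longlonglongrightarrow> 1"
        by (rule tendsto_eventually)
      show ?case
        using tendsto_mult[OF 1 2] by (simp add: h_def)
    qed
  qed
  then show ?thesis
    unfolding closure_sequential using h_mem by (intro exI[of _ "\<lambda>n. l2_of (h n)"]) auto
qed

text \<open>Truncating f at height k reduces to the bounded case: the truncations differ from f by
  at most |f| and agree with f at each point for large k.\<close>

lemma closure_inner_supported: "closure (l2_of ` inner_supported) = UNIV"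
proof -
  have "u \<in> closure (l2_of ` inner_supported)" for u
  proof -
    obtain f where f: "square_integrable f" and u: "u = l2_of f"
      using l2_of_rep by blast
    define g where "g k x = max (- real k) (min (real k) (f x))" for k :: nat and x
    have [measurable]: "f \<in> borel_measurable unit_measure"
      by (rule square_integrable_measurable[OF f])
    have g_meas: "g k \<in> borel_measurable unit_measure" for k
      unfolding g_def by measurable
    have g_bound: "\<bar>g k x\<bar> \<le> real k" for k x
      by (auto simp: g_def)
    have "(\<lambda>k. l2_of (g k)) \<longlonglongrightarrow> l2_of f"
    proof (rule l2_of_tendsto)
      show "square_integrable (g k)" for k
        by (rule square_integrable_bounded[OF g_meas g_bound])
      show "square_integrable (\<lambda>x. \<bar>f x\<bar>)"
        using f by (auto simp: square_integrable_def)
      show "\<bar>g k x - f x\<bar> \<le> \<bar>f x\<bar>" for k x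
        by (auto simp: g_def)
      show "AE x in unit_measure. (\<lambda>k. g k x) \<longlonglongrightarrow> f x"
      proof (rule AE_I2)
        fix x
        obtain k0 where k0: "\<bar>f x\<bar> < real k0" using reals_Archimedean2 by blast
        have "\<forall>\<^sub>F k in sequentially. g k x = f x"
          using eventually_ge_at_top[of k0] by eventually_elim (use k0 in \<open>auto simp: g_def\<close>)
        then show "(\<lambda>k. g k x) \<longlonglongrightarrow> f x" by (rule tendsto_eventually)
      qed
    qed (rule f)
    then have "l2_of f \<in> closure (closure (l2_of ` inner_supported))"
      unfolding closure_sequential[of _ "closure _"]
      by (intro exI[of _ "\<lambda>k. l2_of (g k)"] conjI allI bounded_in_closure[OF g_meas g_bound])
    then show ?thesis by (simp add: u)
  qed
  then show ?thesis by blast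
qed

lemma l2_eq_zero_if_orthogonal:
  assumes "\<And>h. h \<in> inner_supported \<Longrightarrow> inner u (l2_of h) = 0"
  shows "u = 0"
proof -
  have "closure (l2_of ` inner_supported) \<subseteq> {v. inner u v = 0}"
    by (intro closure_minimal closed_Collect_eq continuous_intros) (use assms in auto)
  then have "inner u u = 0"
    unfolding closure_inner_supported by blast
  then show ?thesis by simp
qed

section \<open>The cosine bases\<close>

lemma inner_cos:
  "inner (l2_of (\<lambda>x. cos (\<alpha> * x))) (l2_of (\<lambda>x. cos (\<beta> * x))) =
     (integral {0..1} (\<lambda>x. cos ((\<alpha> - \<beta>) * x)) + integral {0..1} (\<lambda>x. cos ((\<alpha> + \<beta>) * x))) / 2"
proof -
  have "inner (l2_of (\<lambda>x. cos (\<alpha> * x))) (l2_of (\<lambda>x. cos (\<beta> * x))) =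
      integral {0..1} (\<lambda>x. cos (\<alpha> * x) * cos (\<beta> * x))"
    by (intro inner_continuous continuous_intros)
  also have "\<dots> = integral {0..1} (\<lambda>x. (cos ((\<alpha> - \<beta>) * x) + cos ((\<alpha> + \<beta>) * x)) / 2)"
    by (simp add: cos_times_cos distrib_right left_diff_distrib)
  also have "\<dots> = integral {0..1} (\<lambda>x. cos ((\<alpha> - \<beta>) * x) + cos ((\<alpha> + \<beta>) * x)) / 2"
    by (rule integral_divide)
  also have "integral {0..1} (\<lambda>x. cos ((\<alpha> - \<beta>) * x) + cos ((\<alpha> + \<beta>) * x)) =
      integral {0..1} (\<lambda>x. cos ((\<alpha> - \<beta>) * x)) + integral {0..1} (\<lambda>x. cos ((\<alpha> + \<beta>) * x))"
    by (intro integral_add integrable_continuous_interval continuous_intros)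
  finally show ?thesis .
qed

lemma integral_cos:
  fixes \<gamma> :: real
  assumes "\<gamma> \<noteq> 0"
  shows "integral {0..1} (\<lambda>x. cos (\<gamma> * x)) = sin \<gamma> / \<gamma>"
proof -
  have "((\<lambda>x. cos (\<gamma> * x)) has_integral (sin (\<gamma> * 1) / \<gamma> - sin (\<gamma> * 0) / \<gamma>)) {0..1}"
    by (rule fundamental_theorem_of_calculus[of 0 1 "\<lambda>x. sin (\<gamma> * x) / \<gamma>"])
       (use assms in \<open>auto intro!: derivative_eq_intros simp flip: has_real_derivative_iff_has_vector_derivative\<close>)
  then show ?thesis by (simp add: integral_unique)
qed

lemma integral_cos_int:
  "integral {0..1} (\<lambda>x. cos (real_of_int k * pi * x)) = (if k = 0 then 1 else 0)"
proof (cases "k = 0")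
  case False
  then show ?thesis
    using integral_cos[of "real_of_int k * pi"] sin_npi_int[of k] by (simp add: mult.commute)
qed simp

text \<open>The shift \<theta> = 0 gives the Neumann eigenfunctions, \<theta> = 1/2 those that are
  Neumann at 0 and Dirichlet at 1; the parameter lets one density proof serve both.\<close>

definition cosine :: "real \<Rightarrow> nat \<Rightarrow> l2" where
  "cosine \<theta> j = l2_of (\<lambda>x. cos ((real j + \<theta>) * pi * x))"

text \<open>Products of \<open>cos (\<pi> x)\<close> with a frequency in \<open>\<int> + \<theta>\<close> stay in the span, since \<open>2 \<theta>\<close>
  is an integer and so reflecting a frequency does not leave \<open>\<int> + \<theta>\<close>.\<close>

lemma cos_power_in_span:
  fixes \<theta> :: real
  assumes \<theta>: "\<theta> = 0 \<or> \<theta> = 1/2"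
  shows "l2_of (\<lambda>x. cos (pi * x) ^ k * cos ((real_of_int z + \<theta>) * pi * x)) \<in> span (range (cosine \<theta>))"
proof (induction k arbitrary: z)
  case 0
  show ?case
  proof (cases "0 \<le> z")
    case True
    then show ?thesis
      by (intro span_base) (auto simp: cosine_def intro!: image_eqI[of _ _ "nat z"])
  next
    case False
    have "0 \<le> - z - \<lfloor>2 * \<theta>\<rfloor> \<and> real_of_int \<lfloor>2 * \<theta>\<rfloor> = 2 * \<theta>"
    proof (rule disjE[OF \<theta>])
      assume half: "\<theta> = 1/2"
      show ?thesis unfolding half using False by simp
    qed (use False in simp)
    then have n: "real (nat (- z - \<lfloor>2 * \<theta>\<rfloor>)) = - real_of_int z - 2 * \<theta>"
      by simp
    have "(real (nat (- z - \<lfloor>2 * \<theta>\<rfloor>)) + \<theta>) * pi * x = - ((real_of_int z + \<theta>) * pi * x)" for x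
      unfolding n by (simp add: algebra_simps)
    then have "cos ((real (nat (- z - \<lfloor>2 * \<theta>\<rfloor>)) + \<theta>) * pi * x) = cos ((real_of_int z + \<theta>) * pi * x)" for x
      by (simp only: cos_minus)
    then show ?thesis
      by (intro span_base) (auto simp: cosine_def intro!: image_eqI[of _ _ "nat (- z - \<lfloor>2 * \<theta>\<rfloor>)"])
  qed
next
  case (Suc k)
  let ?f = "\<lambda>z x. cos (pi * x) ^ k * cos ((real_of_int z + \<theta>) * pi * x)"
  have sq: "square_integrable (?f z)" for z
    by (intro square_integrable_continuous continuous_intros)
  have "cos (pi * x) ^ Suc k * cos ((real_of_int z + \<theta>) * pi * x) = 1/2 * (?f (z + 1) x + ?f (z - 1) x)" for x
  proof -
    let ?A = "(real_of_int z + \<theta>) * pi * x"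
    have e1: "(real_of_int (z + 1) + \<theta>) * pi * x = ?A + pi * x"
      and e2: "(real_of_int (z - 1) + \<theta>) * pi * x = ?A - pi * x"
      by (simp_all add: algebra_simps)
    show ?thesis
      unfolding e1 e2 cos_add cos_diff by (simp add: algebra_simps)
  qed
  then have "l2_of (\<lambda>x. cos (pi * x) ^ Suc k * cos ((real_of_int z + \<theta>) * pi * x)) =
      (1/2) *\<^sub>R (l2_of (?f (z + 1)) + l2_of (?f (z - 1)))"
    by (simp only: l2_of_cmult[OF square_integrable_add[OF sq sq]] l2_of_add[OF sq sq])
  then show ?case
    by (simp only:) (intro span_scale span_add Suc.IH)
qed

lemma cos_polynomial_in_span:
  assumes "\<theta> = 0 \<or> \<theta> = 1/2"
  shows "l2_of (\<lambda>x. (\<Sum>i\<le>n. c i * cos (pi * x) ^ i) * cos (\<theta> * pi * x)) \<in> span (range (cosine \<theta>))"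
proof (induction n)
  have sq: "square_integrable (\<lambda>x. cos (pi * x) ^ i * cos (\<theta> * pi * x))" for i
    by (intro square_integrable_continuous continuous_intros)
  have mem: "c i *\<^sub>R l2_of (\<lambda>x. cos (pi * x) ^ i * cos (\<theta> * pi * x)) \<in> span (range (cosine \<theta>))" for i
    using cos_power_in_span[OF assms, of i 0] by (intro span_scale) simp
  {
    case 0
    then show ?case
      using mem[of 0] l2_of_cmult[OF sq[of 0], of "c 0"] by (simp add: mult.assoc)
  next
    case (Suc n)
    have sqn: "square_integrable (\<lambda>x. (\<Sum>i\<le>n. c i * cos (pi * x) ^ i) * cos (\<theta> * pi * x))"
      by (intro square_integrable_continuous continuous_intros)
    have "l2_of (\<lambda>x. (\<Sum>i\<le>Suc n. c i * cos (pi * x) ^ i) * cos (\<theta> * pi * x)) =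
        l2_of (\<lambda>x. (\<Sum>i\<le>n. c i * cos (pi * x) ^ i) * cos (\<theta> * pi * x) +
          c (Suc n) * (cos (pi * x) ^ Suc n * cos (\<theta> * pi * x)))"
      by (simp only: sum.atMost_Suc distrib_right mult.assoc)
    also have "\<dots> = l2_of (\<lambda>x. (\<Sum>i\<le>n. c i * cos (pi * x) ^ i) * cos (\<theta> * pi * x)) +
        c (Suc n) *\<^sub>R l2_of (\<lambda>x. cos (pi * x) ^ Suc n * cos (\<theta> * pi * x))"
      by (simp only: l2_of_add[OF sqn square_integrable_cmult[OF sq]] l2_of_cmult[OF sq])
    finally show ?case
      using span_add[OF Suc mem[of "Suc n"]] by simp
  }
qed

text \<open>Divide h by cos (\<theta> pi x), approximate the quotient by a polynomial in cos (pi x),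
  and multiply back; the products lie in the span. For \<theta> = 1/2 the divisor vanishes at x = 1,
  near which h is zero, so functions supported inside the interval are the right ones to
  approximate.\<close>

lemma closure_span_cosine:
  assumes \<theta>: "\<theta> = 0 \<or> \<theta> = 1/2"
  shows "closure (span (range (cosine \<theta>))) = UNIV"
proof -
  have "l2_of h \<in> closure (span (range (cosine \<theta>)))" if h: "h \<in> inner_supported" for h
    unfolding closure_approachable
  proof (intro allI impI)
    fix \<epsilon> :: real assume \<epsilon>: "0 < \<epsilon>"
    obtain \<delta> where \<delta>: "0 < \<delta>" "\<And>x. x \<notin> {\<delta>..1 - \<delta>} \<Longrightarrow> h x = 0"
      using h unfolding inner_supported_def by blast
    \<comment> \<open>The margin \<delta> may exceed 1; the cap keeps 1 - \<delta>' nonnegative, so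
      that \<eta> is the cosine of an angle in [0, pi/2).\<close>
    define \<delta>' where "\<delta>' = min \<delta> 1"
    have \<delta>': "0 < \<delta>'" "\<delta>' \<le> 1"
      using \<delta> by (auto simp: \<delta>'_def)
    have h0: "h x = 0" if "x \<notin> {\<delta>'..1 - \<delta>'}" for x
      by (rule \<delta>(2)) (use that in \<open>auto simp: \<delta>'_def\<close>)
    define \<eta> where "\<eta> = cos (\<theta> * pi * (1 - \<delta>'))"
    have \<eta>: "0 < \<eta>"
      unfolding \<eta>_def using \<theta> \<delta>' by (auto intro!: cos_gt_zero_pi simp: field_simps)
    \<comment> \<open>The maximum makes the denominator positive on the whole line without changing
      the quotient on [0, 1]: up to 1 - \<delta>' the cosine is at least \<eta>, and beyond that
      point h vanishes.\<close>
    define q where "q x = h x / max (cos (\<theta> * pi * x)) \<eta>" for x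
    have qh: "h x = q x * cos (\<theta> * pi * x)" if x: "x \<in> {0..1}" for x
    proof (cases "x \<le> 1 - \<delta>'")
      case True
      have "cos (\<theta> * pi * (1 - \<delta>')) \<le> cos (\<theta> * pi * x)"
      proof (rule cos_monotone_0_pi_le)
        show "0 \<le> \<theta> * pi * x" using \<theta> x by auto
        show "\<theta> * pi * x \<le> \<theta> * pi * (1 - \<delta>')" using \<theta> True by (intro mult_left_mono) auto
        show "\<theta> * pi * (1 - \<delta>') \<le> pi" 
          using mult_mono[of "\<theta> * pi" pi "1 - \<delta>'" 1] \<theta> \<delta>' by auto
      qed
      then show ?thesis using \<eta> by (simp add: q_def \<eta>_def max_def)
    next
      case False
      then show ?thesis using h0[of x] by (simp add: q_def)
    qed
    \<comment> \<open>The substitution t = cos (pi x) turns approximation by powers of cos (pi x)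
      into Stone-Weierstrass on [-1, 1].\<close>
    have "continuous_on {-1..1} (\<lambda>t. q (arccos t / pi))"
      unfolding q_def using \<eta> 
      by (intro continuous_intros continuous_on_compose2[OF inner_supported_continuous[OF h, of UNIV]])
         (auto simp: max_def)
    then obtain p where p: "real_polynomial_function p"
      "\<And>t. t \<in> {-1..1} \<Longrightarrow> \<bar>q (arccos t / pi) - p t\<bar> < \<epsilon> / 2"
      using Stone_Weierstrass_real_polynomial_function[of "{-1..1}" _ "\<epsilon> / 2"] \<epsilon>
      by (metis compact_Icc half_gt_zero)
    obtain c n where c: "p = (\<lambda>t. \<Sum>i\<le>n. c i * t ^ i)"
      using p(1) unfolding real_polynomial_function_iff_sum by blast
    define g where "g x = (\<Sum>i\<le>n. c i * cos (pi * x) ^ i) * cos (\<theta> * pi * x)" for x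
    have "norm (l2_of (\<lambda>x. g x - h x)) \<le> \<epsilon> / 2"
    proof (rule norm_l2_of_le)
      fix x :: real assume x: "x \<in> {0<..<1}"
      have "arccos (cos (pi * x)) / pi = x"
        using x by (subst arccos_cos) (auto simp: mult_le_cancel_left1)
      then have "\<bar>q x - p (cos (pi * x))\<bar> < \<epsilon> / 2"
        using p(2)[of "cos (pi * x)"] by simp
      then have "\<bar>p (cos (pi * x)) - q x\<bar> * \<bar>cos (\<theta> * pi * x)\<bar> \<le> \<epsilon> / 2 * 1"
        using \<epsilon> by (intro mult_mono) (auto simp: abs_minus_commute)
      moreover have "g x - h x = (p (cos (pi * x)) - q x) * cos (\<theta> * pi * x)"
        using qh[of x] x by (simp add: g_def c left_diff_distrib)
      ultimately show "\<bar>g x - h x\<bar> \<le> \<epsilon> / 2"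
        by (simp add: abs_mult)
    qed (use \<epsilon> in simp)
    moreover have "square_integrable g" "square_integrable h"
      unfolding g_def
      by (intro square_integrable_continuous continuous_intros inner_supported_continuous[OF h])+
    ultimately have "dist (l2_of g) (l2_of h) < \<epsilon>"
      using \<epsilon> by (simp add: l2_of_diff dist_norm)
    then show "\<exists>y\<in>span (range (cosine \<theta>)). dist y (l2_of h) < \<epsilon>"
      using cos_polynomial_in_span[OF \<theta>, of c n] unfolding g_def by blast
  qed
  then have "closure (l2_of ` inner_supported) \<subseteq> closure (span (range (cosine \<theta>)))"
    by (intro closure_minimal) auto
  then show ?thesis
    unfolding closure_inner_supported by blast
qed

lemma inner_cosine_half: "inner (cosine (1/2) i) (cosine (1/2) j) = (if i = j then 1/2 else 0)"
proof -
  have e1: "(real i + 1/2) * pi - (real j + 1/2) * pi = real_of_int (int i - int j) * pi"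
    and e2: "(real i + 1/2) * pi + (real j + 1/2) * pi = real_of_int (int i + int j + 1) * pi"
    by (simp_all add: algebra_simps)
  have "int i + int j + 1 \<noteq> 0" by linarith
  then show ?thesis
    unfolding cosine_def inner_cos e1 e2 integral_cos_int by simp
qed

text \<open>For i = j = 0 the sum of the frequencies vanishes as well as their difference, so both
  integrals contribute. This exceptional value is what \<open>mu\<close> normalizes.\<close>

lemma inner_cosine_zero:
  "inner (cosine 0 i) (cosine 0 j) = (if i = j then if i = 0 then 1 else 1/2 else 0)"
proof -
  have e1: "(real i + 0) * pi - (real j + 0) * pi = real_of_int (int i - int j) * pi"
    and e2: "(real i + 0) * pi + (real j + 0) * pi = real_of_int (int i + int j) * pi"
    by (simp_all add: algebra_simps)
  show ?thesis
    unfolding cosine_def inner_cos e1 e2 integral_cos_int by auto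
qed

text \<open>Here \<open>dn\<close> means Dirichlet at 1 and Neumann at 0, and \<open>nn\<close>
  below means Neumann at both ends.\<close>

definition dn_basis :: "nat \<Rightarrow> l2" where "dn_basis n = sqrt 2 *\<^sub>R cosine (1/2) n"

definition nn_basis :: "nat \<Rightarrow> l2" where "nn_basis m = mu m *\<^sub>R cosine 0 m"

lemma mu_pos: "0 < mu m" by (simp add: mu_def)

lemma closure_span_scaled:
  fixes e :: "nat \<Rightarrow> 'a::real_normed_vector"
  assumes "closure (span (range e)) = UNIV" and "\<And>n. c n \<noteq> 0"
  shows "closure (span (range (\<lambda>n. c n *\<^sub>R e n))) = UNIV"
proof -
  have "e n \<in> span (range (\<lambda>n. c n *\<^sub>R e n))" for n
    using span_scale[OF span_base, of "c n *\<^sub>R e n" "range (\<lambda>n. c n *\<^sub>R e n)" "1 / c n"] assms(2)[of n]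
    by auto
  then have "span (range e) \<subseteq> span (range (\<lambda>n. c n *\<^sub>R e n))"
    by (intro span_minimal) auto
  then show ?thesis
    using closure_mono assms(1) by blast
qed

lemma orthonormal_basis_dn: "orthonormal_basis dn_basis"
proof
  show "inner (dn_basis i) (dn_basis j) = (if i = j then 1 else 0)" for i j
    by (simp add: dn_basis_def inner_cosine_half)
  show "closure (span (range dn_basis)) = UNIV"
    unfolding dn_basis_def[abs_def] by (rule closure_span_scaled[OF closure_span_cosine]) auto
qed

lemma orthonormal_basis_nn: "orthonormal_basis nn_basis"
proof
  show "inner (nn_basis i) (nn_basis j) = (if i = j then 1 else 0)" for i j
    by (simp add: nn_basis_def inner_cosine_zero mu_def)
  show "closure (span (range nn_basis)) = UNIV"
    unfolding nn_basis_def[abs_def]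
    by (rule closure_span_scaled[OF closure_span_cosine]) (auto simp: mu_pos less_imp_neq[symmetric])
qed

section \<open>Weak derivatives and the Volterra operator\<close>

definition one :: l2 where "one = l2_of (\<lambda>x. 1)"

text \<open>\<open>prim u x = \<integral>\<^sub>0\<^sup>x u\<close>; writing the integral as an inner product avoids choosing a representative of \<open>u\<close>.\<close>

definition prim :: "l2 \<Rightarrow> real \<Rightarrow> real" where
  "prim u x = inner u (l2_of (indicat_real {0..x}))"

lemma square_integrable_indicator: "square_integrable (indicat_real {a..b})"
proof (rule square_integrable_bounded)
  have "indicat_real {a..b} \<in> borel_measurable lebesgue"
    by (rule borel_measurable_indicator) simp
  then show "indicat_real {a..b} \<in> borel_measurable unit_measure"
    by (rule measurable_restrict_space1)
  show "\<bar>indicat_real {a..b} x\<bar> \<le> 1" for x by (simp add: indicator_def)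
qed

text \<open>The indicator of [0, x] depends continuously on x in L^2, by dominated convergence:
  pointwise convergence can fail only at the single point y = x.\<close>

lemma continuous_prim: "continuous_on {0..1} (prim u)"
proof -
  have "continuous_on UNIV (\<lambda>x. l2_of (indicat_real {0..x}))"
  proof (rule continuous_on_sequentiallyI)
    fix X and x :: real assume X: "X \<longlonglongrightarrow> x"
    show "(\<lambda>n. l2_of (indicat_real {0..X n})) \<longlonglongrightarrow> l2_of (indicat_real {0..x})"
    proof (rule l2_of_tendsto)
      show "\<bar>indicat_real {0..X k} y - indicat_real {0..x} y\<bar> \<le> 1" for k y
        by (simp add: indicator_def)
      have "AE y in lebesgue. y \<noteq> x"
        by (rule AE_completion) (rule AE_lborel_singleton)
      then have "AE y in lebesgue. y \<in> {0<..<1} \<longrightarrow> y \<noteq> x"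
        by eventually_elim simp
      then have "AE y in unit_measure. y \<noteq> x"
        by (simp add: AE_restrict_space_iff)
      then show "AE y in unit_measure. (\<lambda>k. indicat_real {0..X k} y) \<longlonglongrightarrow> indicat_real {0..x} y"
      proof eventually_elim
        case (elim y)
        have "\<forall>\<^sub>F k in sequentially. indicat_real {0..X k} y = indicat_real {0..x} y"
        proof (cases "y < x")
          case True
          show ?thesis
            using order_tendstoD(1)[OF X True] by eventually_elim (use True in \<open>simp add: indicator_def\<close>)
        next
          case False
          then have "x < y" using elim by simp
          show ?thesis
            using order_tendstoD(2)[OF X \<open>x < y\<close>]
            by eventually_elim (use \<open>x < y\<close> in \<open>simp add: indicator_def\<close>)
        qed
        then show ?case by (rule tendsto_eventually)
      qed
    qed (auto intro: square_integrable_indicator square_integrable_continuous)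
  qed
  then have "continuous_on {0..1} (\<lambda>x. l2_of (indicat_real {0..x}))"
    by (rule continuous_on_subset) simp
  then show ?thesis
    unfolding prim_def[abs_def] by (intro continuous_intros)
qed

lemma square_integrable_prim: "square_integrable (prim u)"
  by (rule square_integrable_continuous[OF continuous_prim])

lemma prim_0: "prim u 0 = 0"
proof -
  have "l2_of (indicat_real {0..0}) = l2_of (\<lambda>x. 0)"
    by (rule l2_of_cong) (simp add: indicator_def)
  then show ?thesis by (simp add: prim_def l2_of_zero)
qed

lemma prim_1: "prim u 1 = inner u one"
proof -
  have "l2_of (indicat_real {0..1}) = one"
    unfolding one_def by (rule l2_of_cong) (simp add: indicator_def)
  then show ?thesis by (simp add: prim_def)
qed

lemma abs_prim_le: "\<bar>prim u x\<bar> \<le> norm u"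
proof -
  have "norm (l2_of (indicat_real {0..x})) \<le> 1"
    by (rule norm_l2_of_le) (auto simp: indicator_def)
  then have "norm u * norm (l2_of (indicat_real {0..x})) \<le> norm u * 1"
    by (intro mult_left_mono) auto
  then show ?thesis
    using Cauchy_Schwarz_ineq2[of u "l2_of (indicat_real {0..x})"] by (simp add: prim_def)
qed

lemma prim_continuous:
  assumes h: "continuous_on {0..1} h" and x: "x \<in> {0..1}"
  shows "prim (l2_of h) x = integral {0..x} h"
proof -
  have sq: "square_integrable h" by (rule square_integrable_continuous[OF h])
  have "prim (l2_of h) x = integral\<^sup>L unit_measure (\<lambda>y. h y * indicat_real {0..x} y)"
    unfolding prim_def by (rule inner_l2_of[OF sq square_integrable_indicator])
  also have "\<dots> = integral {0..1} (\<lambda>y. h y * indicat_real {0..x} y)"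
    by (rule lebesgue_integral_unit[OF l2_integrable_mult[OF sq square_integrable_indicator]])
  also have "\<dots> = integral {0..1} (\<lambda>y. if y \<in> {0..x} then h y else 0)"
    by (rule integral_cong) (simp add: indicator_def)
  also have "\<dots> = integral ({0..x} \<inter> {0..1}) h"
    by (rule integral_restrict_Int)
  also have "{0..x} \<inter> {0..1} = {0..x}" using x by auto
  finally show ?thesis .
qed

definition volterra :: "l2 \<Rightarrow> l2" where "volterra u = l2_of (prim u)"

lemma bounded_linear_volterra: "bounded_linear volterra"
proof (rule bounded_linear_intro)
  show "volterra (u + v) = volterra u + volterra v" for u v
    unfolding volterra_def l2_of_add[OF square_integrable_prim square_integrable_prim, symmetric]
    by (simp add: prim_def[abs_def] inner_add_left)
  show "volterra (c *\<^sub>R u) = c *\<^sub>R volterra u" for c u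
    unfolding volterra_def l2_of_cmult[OF square_integrable_prim, symmetric]
    by (simp add: prim_def[abs_def])
  show "norm (volterra u) \<le> norm u * 1" for u
    unfolding volterra_def by (rule norm_l2_of_le) (auto simp: abs_prim_le)
qed

lemmas volterra_add = bounded_linear.linear[OF bounded_linear_volterra, THEN linear_add]
lemmas volterra_diff = bounded_linear.linear[OF bounded_linear_volterra, THEN linear_diff]
lemmas volterra_scaleR = bounded_linear.linear[OF bounded_linear_volterra, THEN linear_cmul]

text \<open>Taking \<psi>(1) - \<psi>, which vanishes at 1, leaves no boundary term. For continuous
  data this is the fundamental theorem of calculus; both sides are continuous in u, so it extends by
  density.\<close>

lemma volterra_by_parts:
  assumes \<psi>: "\<And>x. x \<in> {0..1} \<Longrightarrow> (\<psi> has_real_derivative \<psi>' x) (at x within {0..1})"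
    and \<psi>': "continuous_on {0..1} \<psi>'"
  shows "inner (volterra u) (l2_of \<psi>') = inner u (l2_of (\<lambda>x. \<psi> 1 - \<psi> x))"
proof -
  have \<psi>_cont: "continuous_on {0..1} \<psi>"
    unfolding continuous_on_eq_continuous_within
    using \<psi> has_field_derivative_imp_has_derivative has_derivative_continuous by blast
  have dense: "inner (volterra (l2_of h)) (l2_of \<psi>') - inner (l2_of h) (l2_of (\<lambda>x. \<psi> 1 - \<psi> x)) = 0"
    if "h \<in> inner_supported" for h
  proof -
    have h: "continuous_on {0..1} h" by (rule inner_supported_continuous[OF that])
    have H: "continuous_on {0..1} (\<lambda>x. integral {0..x} h)"
      by (rule continuous_on_eq[OF continuous_prim[of "l2_of h"]]) (rule prim_continuous[OF h])
    have V: "volterra (l2_of h) = l2_of (\<lambda>x. integral {0..x} h)"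
      unfolding volterra_def by (rule l2_of_cong) (simp add: prim_continuous[OF h])
    have "((\<lambda>x. integral {0..x} h * \<psi>' x - h x * (\<psi> 1 - \<psi> x)) has_integral
        - (integral {0..1} h * (\<psi> 1 - \<psi> 1)) - - (integral {0..0} h * (\<psi> 1 - \<psi> 0))) {0..1}"
    \<comment> \<open>This product vanishes at both ends, through its first factor at 0 and its
      second at 1.\<close>
    proof (rule fundamental_theorem_of_calculus[of 0 1 "\<lambda>x. - (integral {0..x} h * (\<psi> 1 - \<psi> x))"])
      fix x :: real assume x: "x \<in> {0..1}"
      show "((\<lambda>x. - (integral {0..x} h * (\<psi> 1 - \<psi> x))) has_vector_derivative
          integral {0..x} h * \<psi>' x - h x * (\<psi> 1 - \<psi> x)) (at x within {0..1})"
        unfolding has_real_derivative_iff_has_vector_derivative[symmetric]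
        by (rule derivative_eq_intros integral_has_real_derivative[OF h x] \<psi>[OF x] refl | simp)+
    qed simp
    then have "integral {0..1} (\<lambda>x. integral {0..x} h * \<psi>' x - h x * (\<psi> 1 - \<psi> x)) = 0"
      by (simp add: integral_unique)
    moreover have "integral {0..1} (\<lambda>x. integral {0..x} h * \<psi>' x - h x * (\<psi> 1 - \<psi> x)) =
        integral {0..1} (\<lambda>x. integral {0..x} h * \<psi>' x) - integral {0..1} (\<lambda>x. h x * (\<psi> 1 - \<psi> x))"
      by (intro integral_diff integrable_continuous_interval continuous_intros h H \<psi>_cont \<psi>')
    ultimately show ?thesis
      by (simp add: V inner_continuous h H \<psi>_cont \<psi>' continuous_on_diff)
  qed
  have "closure (l2_of ` inner_supported) \<subseteq>
      {u. inner (volterra u) (l2_of \<psi>') - inner u (l2_of (\<lambda>x. \<psi> 1 - \<psi> x)) = 0}"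
  proof (rule closure_minimal)
    show "closed {u. inner (volterra u) (l2_of \<psi>') - inner u (l2_of (\<lambda>x. \<psi> 1 - \<psi> x)) = 0}"
      by (intro closed_Collect_eq continuous_intros bounded_linear.continuous_on[OF bounded_linear_volterra])
  qed (use dense in auto)
  then show ?thesis
    unfolding closure_inner_supported by auto
qed

lemma inner_one_continuous:
  "continuous_on {0..1} f \<Longrightarrow> inner one (l2_of f) = integral {0..1} f"
  unfolding one_def by (subst inner_continuous) auto

lemma inner_one_one: "inner one one = 1"
  unfolding one_def by (subst inner_continuous) auto

lemma volterra_plus_const:
  "volterra u + c *\<^sub>R one = l2_of (\<lambda>x. prim u x + c)"
  unfolding volterra_def one_def
  using l2_of_add[OF square_integrable_prim square_integrable_continuous[of "\<lambda>x. c"], of u]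
    l2_of_cmult[OF square_integrable_continuous[of "\<lambda>x. 1"], of c]
  by simp

lemma boundary_value_volterra:
  assumes "x \<in> {0..1}"
  shows "boundary_value (volterra u + c *\<^sub>R one) x = prim u x + c"
  unfolding volterra_plus_const
  by (intro boundary_value_l2_of continuous_intros continuous_prim assms)

section \<open>Weakly differentiable elements are primitives plus constants\<close>

lemma has_weak_deriv_volterra: "has_weak_deriv (volterra v + c *\<^sub>R one) v"
  unfolding has_weak_deriv_def
proof (intro allI impI)
  fix \<phi> \<phi>' :: "real \<Rightarrow> real"
  assume d: "\<forall>x. (\<phi> has_real_derivative \<phi>' x) (at x)" and c: "continuous_on UNIV \<phi>'"
    and "\<exists>K. compact K \<and> K \<subseteq> {0<..<1} \<and> (\<forall>x. x \<notin> K \<longrightarrow> \<phi> x = 0)"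
  then obtain K where "K \<subseteq> {0<..<1}" "\<And>x. x \<notin> K \<Longrightarrow> \<phi> x = 0" by blast
  moreover from this have "0 \<notin> K" "1 \<notin> K" by auto
  ultimately have bv: "\<phi> 0 = 0" "\<phi> 1 = 0" by auto
  have d': "(\<phi> has_real_derivative \<phi>' x) (at x within {0..1})" for x
    using d has_field_derivative_at_within by blast
  have c': "continuous_on {0..1} \<phi>'" by (rule continuous_on_subset[OF c]) simp
  have \<phi>_cont: "continuous_on {0..1} \<phi>"
    using d by (intro continuous_at_imp_continuous_on) (auto intro: DERIV_isCont)
  have "l2_of (\<lambda>x. 0 - \<phi> x) = - l2_of \<phi>"
    using l2_of_diff[OF square_integrable_zero square_integrable_continuous[OF \<phi>_cont]]
    by (simp add: l2_of_zero)
  then have "inner (volterra v) (l2_of \<phi>') = - inner v (l2_of \<phi>)"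
    using volterra_by_parts[OF d' c'] bv by simp
  moreover have "inner one (l2_of \<phi>') = 0"
  proof -
    have "(\<phi>' has_integral \<phi> 1 - \<phi> 0) {0..1}"
      using d' by (intro fundamental_theorem_of_calculus)
        (auto simp flip: has_real_derivative_iff_has_vector_derivative)
    then show ?thesis
      using bv by (simp add: inner_one_continuous[OF c'] integral_unique)
  qed
  ultimately show "inner (volterra v + c *\<^sub>R one) (l2_of \<phi>') = - inner v (l2_of \<phi>)"
    by (simp add: inner_add_left)
qed

text \<open>The primitive starting at 0 is constant on either side of the support of h: it is 0 on
  the left, and on the right it equals the integral of h, which is 0.\<close>

lemma inner_supported_antiderivative:
  assumes h: "h \<in> inner_supported" and int: "integral {0..1} h = 0"
  obtains \<phi> K where "\<And>x. (\<phi> has_real_derivative h x) (at x)" "compact K" "K \<subseteq> {0<..<1}"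
    "\<And>x. x \<notin> K \<Longrightarrow> \<phi> x = 0"
proof -
  obtain \<delta> where \<delta>: "0 < \<delta>" "\<And>x. x \<notin> {\<delta>..1 - \<delta>} \<Longrightarrow> h x = 0" and h_cont: "continuous_on UNIV h"
    using h unfolding inner_supported_def by blast
  have "\<exists>F. \<forall>x::real. - \<infinity> < ereal x \<longrightarrow> ereal x < \<infinity> \<longrightarrow> (F has_vector_derivative h x) (at x)"
    using h_cont by (intro einterval_antiderivative) (auto simp: continuous_on_eq_continuous_at)
  then obtain F where F: "\<And>x. (F has_real_derivative h x) (at x)"
    by (auto simp flip: has_real_derivative_iff_has_vector_derivative)
  define \<phi> where "\<phi> x = F x - F 0" for x
  have d: "(\<phi> has_real_derivative h x) (at x)" for x
    unfolding \<phi>_def using DERIV_diff[OF F DERIV_const] by simp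
  have "(h has_integral \<phi> 1 - \<phi> 0) {0..1}"
    using d by (intro fundamental_theorem_of_calculus)
      (auto intro: has_field_derivative_at_within simp flip: has_real_derivative_iff_has_vector_derivative)
  then have \<phi>1: "\<phi> 1 = 0" using int by (simp add: integral_unique \<phi>_def)
  have z: "\<phi> x = 0" if x: "x \<notin> {\<delta>..1 - \<delta>}" for x
  proof (cases "x < \<delta>")
    case True
    have "\<phi> x = \<phi> 0"
    \<comment> \<open>This interval contains both x and 0 and stays to the left of \<delta>, where h
      is zero; the other side mirrors it with 1 in place of 0.\<close>
    proof (rule DERIV_isconst3[of "min x 0 - 1" \<delta> x 0 \<phi>])
      show "(\<phi> has_real_derivative 0) (at y)" if "y \<in> {min x 0 - 1<..<\<delta>}" for y
        using d[of y] \<delta>(2)[of y] that by auto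
    qed (use True \<delta> in auto)
    then show ?thesis by (simp add: \<phi>_def)
  next
    case False
    then have "1 - \<delta> < x" using x by auto
    have "\<phi> x = \<phi> 1"
    proof (rule DERIV_isconst3[of "1 - \<delta>" "max x 1 + 1" x 1 \<phi>])
      show "(\<phi> has_real_derivative 0) (at y)" if "y \<in> {1 - \<delta><..<max x 1 + 1}" for y
        using d[of y] \<delta>(2)[of y] that by auto
    qed (use \<open>1 - \<delta> < x\<close> \<delta> in auto)
    then show ?thesis by (simp add: \<phi>1)
  qed
  show thesis
    by (rule that[of \<phi> "{\<delta>..1 - \<delta>}", OF d _ _ z]) (use \<delta>(1) in auto)
qed

lemma inner_supported_diff_cmult:
  assumes "h \<in> inner_supported" "g \<in> inner_supported"
  shows "(\<lambda>x. h x - c * g x) \<in> inner_supported"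
proof -
  obtain \<delta> \<delta>' where \<delta>: "0 < \<delta>" "\<And>x. x \<notin> {\<delta>..1 - \<delta>} \<Longrightarrow> h x = 0"
    and \<delta>': "0 < \<delta>'" "\<And>x. x \<notin> {\<delta>'..1 - \<delta>'} \<Longrightarrow> g x = 0"
    using assms unfolding inner_supported_def by blast
  have "h x - c * g x = 0" if "x \<notin> {min \<delta> \<delta>'..1 - min \<delta> \<delta>'}" for x
  proof -
    have "x \<notin> {\<delta>..1 - \<delta>}" "x \<notin> {\<delta>'..1 - \<delta>'}" using that by auto
    then show ?thesis by (simp add: \<delta>(2) \<delta>'(2))
  qed
  then have "\<exists>\<delta>>0. \<forall>x. x \<notin> {\<delta>..1 - \<delta>} \<longrightarrow> h x - c * g x = 0"
    using \<delta>(1) \<delta>'(1) by (intro exI[of _ "min \<delta> \<delta>'"]) auto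
  moreover have "continuous_on UNIV (\<lambda>x. h x - c * g x)"
    by (intro continuous_intros inner_supported_continuous assms)
  ultimately show ?thesis by (simp add: inner_supported_def)
qed

text \<open>The du Bois-Reymond lemma. Fix \<rho> with nonzero mean; subtracting the right multiple
  of \<rho> from any h gives mean zero, hence the derivative of a test function, to which u is
  orthogonal. So u pairs with h as a constant does, and \<rho> determines that constant.\<close>

lemma has_weak_deriv_zero_imp_const:
  assumes "has_weak_deriv u 0"
  shows "\<exists>c. u = c *\<^sub>R one"
proof -
  obtain \<rho> where \<rho>: "\<rho> \<in> inner_supported" "inner one (l2_of \<rho>) \<noteq> 0"
    using l2_eq_zero_if_orthogonal[of one] inner_one_one by (metis inner_zero_left zero_neq_one)
  define c where "c = inner u (l2_of \<rho>) / inner one (l2_of \<rho>)"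
  have "u - c *\<^sub>R one = 0"
  proof (rule l2_eq_zero_if_orthogonal)
    fix h assume h: "h \<in> inner_supported"
    define k where "k = inner one (l2_of h) / inner one (l2_of \<rho>)"
    define \<psi> where "\<psi> x = h x - k * \<rho> x" for x
    have \<psi>: "\<psi> \<in> inner_supported"
      unfolding \<psi>_def[abs_def] by (rule inner_supported_diff_cmult[OF h \<rho>(1)])
    have sq: "square_integrable f" if "f \<in> inner_supported" for f
      by (rule square_integrable_continuous[OF inner_supported_continuous[OF that]])
    have l2\<psi>: "l2_of \<psi> = l2_of h - k *\<^sub>R l2_of \<rho>"
      unfolding \<psi>_def[abs_def]
      by (simp add: l2_of_diff[OF sq[OF h] square_integrable_cmult[OF sq[OF \<rho>(1)]]] l2_of_cmult[OF sq[OF \<rho>(1)]])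
    have "integral {0..1} \<psi> = inner one (l2_of \<psi>)"
      by (rule inner_one_continuous[OF inner_supported_continuous[OF \<psi>], symmetric])
    also have "\<dots> = 0" using \<rho>(2) by (simp add: l2\<psi> inner_diff_right k_def)
    finally obtain \<phi> K where "\<And>x. (\<phi> has_real_derivative \<psi> x) (at x)" "compact K" "K \<subseteq> {0<..<1}"
      "\<And>x. x \<notin> K \<Longrightarrow> \<phi> x = 0"
      using inner_supported_antiderivative[OF \<psi>] by blast
    then have "inner u (l2_of \<psi>) = - inner 0 (l2_of \<phi>)"
      using assms inner_supported_continuous[OF \<psi>, of UNIV] unfolding has_weak_deriv_def by blast
    then have "inner u (l2_of h) = k * inner u (l2_of \<rho>)"
      by (simp add: l2\<psi> inner_diff_right)
    then show "inner (u - c *\<^sub>R one) (l2_of h) = 0"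
      by (simp add: inner_diff_left c_def k_def)
  qed
  then show ?thesis by (intro exI[of _ c]) simp
qed

lemma has_weak_deriv_diff:
  "has_weak_deriv u v \<Longrightarrow> has_weak_deriv u' v' \<Longrightarrow> has_weak_deriv (u - u') (v - v')"
  unfolding has_weak_deriv_def by (simp add: inner_diff_left)

text \<open>\<open>volterra v\<close> has weak derivative v too, so its difference from u has weak
  derivative 0. The converse is \<open>has_weak_deriv_volterra\<close>; together they describe
  \<open>H1\<close> explicitly.\<close>

lemma has_weak_derivD:
  assumes "has_weak_deriv u v"
  obtains c where "u = volterra v + c *\<^sub>R one"
proof -
  have "has_weak_deriv (u - (volterra v + 0 *\<^sub>R one)) (v - v)"
    by (rule has_weak_deriv_diff[OF assms has_weak_deriv_volterra])
  then obtain c where "u - volterra v = c *\<^sub>R one"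
    using has_weak_deriv_zero_imp_const by auto
  then show thesis by (intro that[of c]) (simp add: algebra_simps)
qed

section \<open>Trigonometric coefficients of primitives\<close>

lemma inner_volterra_cos:
  assumes "\<kappa> \<noteq> 0"
  shows "inner (volterra u) (l2_of (\<lambda>x. cos (\<kappa> * x))) =
    (sin \<kappa> * inner u one - inner u (l2_of (\<lambda>x. sin (\<kappa> * x)))) / \<kappa>"
proof -
  have sq: "square_integrable (\<lambda>x. sin (\<kappa> * x) / \<kappa>)" "square_integrable (\<lambda>x. sin \<kappa> / \<kappa>)"
      "square_integrable (\<lambda>x. sin (\<kappa> * x))" "square_integrable (\<lambda>x. 1)"
    by (intro square_integrable_continuous continuous_intros assms; simp add: assms)+
  have "inner (volterra u) (l2_of (\<lambda>x. cos (\<kappa> * x))) =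
      inner u (l2_of (\<lambda>x. sin (\<kappa> * 1) / \<kappa> - sin (\<kappa> * x) / \<kappa>))"
    by (rule volterra_by_parts) (use assms in \<open>auto intro!: derivative_eq_intros continuous_intros\<close>)
  also have "l2_of (\<lambda>x. sin (\<kappa> * 1) / \<kappa> - sin (\<kappa> * x) / \<kappa>) =
      (sin \<kappa> / \<kappa>) *\<^sub>R one - (1 / \<kappa>) *\<^sub>R l2_of (\<lambda>x. sin (\<kappa> * x))"
    using l2_of_diff[OF sq(2,1)] l2_of_cmult[OF sq(3), of "1 / \<kappa>"] l2_of_cmult[OF sq(4), of "sin \<kappa> / \<kappa>"]
    by (simp add: one_def)
  finally show ?thesis by (simp add: inner_diff_right diff_divide_distrib)
qed

lemma inner_volterra_sin:
  assumes "\<kappa> \<noteq> 0"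
  shows "inner (volterra u) (l2_of (\<lambda>x. sin (\<kappa> * x))) =
    (inner u (l2_of (\<lambda>x. cos (\<kappa> * x))) - cos \<kappa> * inner u one) / \<kappa>"
proof -
  have sq: "square_integrable (\<lambda>x. - (cos (\<kappa> * x) / \<kappa>))" "square_integrable (\<lambda>x. - (cos \<kappa> / \<kappa>))"
      "square_integrable (\<lambda>x. cos (\<kappa> * x))" "square_integrable (\<lambda>x. 1)"
    by (intro square_integrable_continuous continuous_intros assms; simp add: assms)+
  have "inner (volterra u) (l2_of (\<lambda>x. sin (\<kappa> * x))) =
      inner u (l2_of (\<lambda>x. - (cos (\<kappa> * 1) / \<kappa>) - - (cos (\<kappa> * x) / \<kappa>)))"
    by (rule volterra_by_parts) (use assms in \<open>auto intro!: derivative_eq_intros continuous_intros\<close>)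
  also have "l2_of (\<lambda>x. - (cos (\<kappa> * 1) / \<kappa>) - - (cos (\<kappa> * x) / \<kappa>)) =
      (1 / \<kappa>) *\<^sub>R l2_of (\<lambda>x. cos (\<kappa> * x)) - (cos \<kappa> / \<kappa>) *\<^sub>R one"
    using l2_of_diff[OF sq(2,1)] l2_of_cmult[OF sq(3), of "- (1 / \<kappa>)"] l2_of_cmult[OF sq(4), of "- (cos \<kappa> / \<kappa>)"]
    by (simp add: one_def)
  finally show ?thesis by (simp add: inner_diff_right diff_divide_distrib)
qed

lemma inner_volterra_volterra_cos:
  assumes "\<kappa> \<noteq> 0"
  shows "\<kappa>\<^sup>2 * inner (volterra (volterra u)) (l2_of (\<lambda>x. cos (\<kappa> * x))) =
    \<kappa> * sin \<kappa> * inner (volterra u) one + cos \<kappa> * inner u one - inner u (l2_of (\<lambda>x. cos (\<kappa> * x)))"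
proof -
  have "\<kappa> * inner (volterra (volterra u)) (l2_of (\<lambda>x. cos (\<kappa> * x))) =
      sin \<kappa> * inner (volterra u) one - inner (volterra u) (l2_of (\<lambda>x. sin (\<kappa> * x)))"
    using assms by (simp add: inner_volterra_cos)
  moreover have "\<kappa> * inner (volterra u) (l2_of (\<lambda>x. sin (\<kappa> * x))) =
      inner u (l2_of (\<lambda>x. cos (\<kappa> * x))) - cos \<kappa> * inner u one"
    using assms by (simp add: inner_volterra_sin)
  ultimately show ?thesis
    by (simp add: power2_eq_square mult.assoc right_diff_distrib)
qed

lemma inner_one_cos: "\<kappa> \<noteq> 0 \<Longrightarrow> inner one (l2_of (\<lambda>x. cos (\<kappa> * x))) = sin \<kappa> / \<kappa>"
  by (subst inner_one_continuous) (auto intro!: continuous_intros simp: integral_cos)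

lemma cos_half_odd_pi: "cos ((real n + 1/2) * pi) = 0"
  by (simp add: distrib_right cos_add)

text \<open>Integrate by parts against the Dirichlet-Neumann cosines: they vanish at \<open>1\<close>, so no boundary
  term remains.\<close>

lemma volterra_eq_zero_imp_zero:
  assumes "volterra u = 0"
  shows "u = 0"
proof (rule orthonormal_basis.eq_zero_if_coeffs_zero[OF orthonormal_basis_dn])
  fix n
  let ?\<kappa> = "(real n + 1/2) * pi"
  have \<kappa>: "?\<kappa> \<noteq> 0" by (simp add: add_nonneg_eq_0_iff)
  have "inner u (l2_of (\<lambda>x. cos (?\<kappa> * x))) = 0"
    using inner_volterra_sin[OF \<kappa>, of u] \<kappa> assms by (simp add: cos_half_odd_pi)
  then show "inner u (dn_basis n) = 0"
    by (simp add: dn_basis_def cosine_def)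
qed

text \<open>Subtracting, a primitive plus c vanishes; its continuous representative takes the value
  c at 0, so c = 0, and injectivity of \<open>volterra\<close> finishes. This justifies the
  \<open>THE\<close> in \<open>weak_deriv\<close>.\<close>

lemma weak_deriv_unique:
  assumes "has_weak_deriv u v" "has_weak_deriv u v'"
  shows "v = v'"
proof -
  obtain c where "u - u = volterra (v - v') + c *\<^sub>R one"
    using has_weak_derivD[OF has_weak_deriv_diff[OF assms]] by blast
  then have z: "volterra (v - v') + c *\<^sub>R one = 0" by simp
  have "c = boundary_value (volterra (v - v') + c *\<^sub>R one) 0"
    by (simp add: boundary_value_volterra prim_0)
  also have "\<dots> = boundary_value (volterra 0 + 0 *\<^sub>R one) 0"
    using z bounded_linear.linear[OF bounded_linear_volterra] by (simp add: linear_0)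
  also have "\<dots> = 0"
    by (subst boundary_value_volterra) (auto simp: prim_0)
  finally have "volterra (v - v') = 0" using z by simp
  then show ?thesis using volterra_eq_zero_imp_zero by fastforce
qed

lemma weak_deriv_volterra: "weak_deriv (volterra v + c *\<^sub>R one) = v"
  unfolding weak_deriv_def
  by (rule the_equality) (auto intro: has_weak_deriv_volterra weak_deriv_unique)

text \<open>The element of H^2 with second derivative w, slope d at 0 and value c at 0. All of
  \<open>H2\<close> has this form, which turns boundary conditions into equations between w, d and
  c.\<close>

definition antideriv2 :: "l2 \<Rightarrow> real \<Rightarrow> real \<Rightarrow> l2" where
  "antideriv2 w d c = volterra (volterra w + d *\<^sub>R one) + c *\<^sub>R one"

lemma H2_antideriv2:
  "antideriv2 w d c \<in> H2"
  unfolding antideriv2_def H2_def H1_def using has_weak_deriv_volterra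
  by (auto simp: weak_deriv_volterra)

lemma H2_cases:
  assumes "u \<in> H2"
  obtains w d c where "u = antideriv2 w d c"
proof -
  obtain v where v: "has_weak_deriv u v" and w: "weak_deriv u \<in> H1"
    using assms unfolding H2_def H1_def by blast
  obtain c where c: "u = volterra v + c *\<^sub>R one" using v by (rule has_weak_derivD)
  then obtain w where "has_weak_deriv v w"
    using w by (auto simp: weak_deriv_volterra H1_def)
  then obtain d where "v = volterra w + d *\<^sub>R one" by (rule has_weak_derivD)
  then show thesis using c that by (simp add: antideriv2_def)
qed

lemma weak_deriv_antideriv2:
  "weak_deriv (antideriv2 w d c) = volterra w + d *\<^sub>R one"
  "weak_deriv (volterra w + d *\<^sub>R one) = w"
  by (simp_all add: antideriv2_def weak_deriv_volterra)

lemma boundary_value_antideriv2: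
  "boundary_value (antideriv2 w d c) 0 = c"
  "boundary_value (antideriv2 w d c) 1 = inner (volterra w) one + d + c"
  "boundary_value (volterra w + d *\<^sub>R one) 0 = d"
  "boundary_value (volterra w + d *\<^sub>R one) 1 = inner w one + d"
  by (simp_all add: antideriv2_def boundary_value_volterra prim_0 prim_1 inner_add_left inner_one_one)

section \<open>The decoupled operators\<close>

lemma weak_deriv_volterra_only: "weak_deriv (volterra w) = w"
  using weak_deriv_volterra[of w 0] by simp

definition dn_dom :: "l2 set" where
  "dn_dom = {u \<in> H2. boundary_value u 1 = 0 \<and> boundary_value (weak_deriv u) 0 = 0}"

definition nn_dom :: "l2 set" where
  "nn_dom = {u \<in> H2. boundary_value (weak_deriv u) 0 = 0 \<and> boundary_value (weak_deriv u) 1 = 0}"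

lemma boundary_value_volterra_only:
  "boundary_value (volterra w) 0 = 0" "boundary_value (volterra w) 1 = inner w one"
  using boundary_value_antideriv2(3,4)[of w 0] by simp_all

lemma antideriv2_in_dn_dom:
  "antideriv2 w d c \<in> dn_dom \<longleftrightarrow> d = 0 \<and> inner (volterra w) one + c = 0"
  by (auto simp: dn_dom_def H2_antideriv2 boundary_value_antideriv2 weak_deriv_antideriv2)

lemma antideriv2_in_nn_dom:
  "antideriv2 w d c \<in> nn_dom \<longleftrightarrow> d = 0 \<and> inner w one = 0"
  by (auto simp: nn_dom_def H2_antideriv2 boundary_value_antideriv2 weak_deriv_antideriv2)

text \<open>Green's identity for u with u'(0) = 0: the bracket is u(1), and
  \<open>inner w one\<close> is u'(1). For half-integer multiples of pi the cosine factor vanishes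
  and u(1) = 0 removes the rest; for integer multiples the sine factor vanishes and u'(1) = 0
  removes the rest.\<close>

lemma inner_antideriv2_cos:
  assumes "\<kappa> \<noteq> 0"
  shows "\<kappa>\<^sup>2 * inner (antideriv2 w 0 c) (l2_of (\<lambda>x. cos (\<kappa> * x))) =
    \<kappa> * sin \<kappa> * (inner (volterra w) one + c) + cos \<kappa> * inner w one - inner w (l2_of (\<lambda>x. cos (\<kappa> * x)))"
proof -
  have "\<kappa>\<^sup>2 * (c * (sin \<kappa> / \<kappa>)) = \<kappa> * sin \<kappa> * c"
    using assms by (simp add: power2_eq_square)
  then show ?thesis
    using inner_volterra_volterra_cos[OF assms, of w] assms
    by (simp add: antideriv2_def inner_add_left inner_one_cos distrib_left)
qed

lemma inner_dn_basis:
  assumes "antideriv2 w 0 c \<in> dn_dom"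
  shows "((real n + 1/2) * pi)\<^sup>2 * inner (antideriv2 w 0 c) (dn_basis n) = - inner w (dn_basis n)"
proof -
  let ?\<kappa> = "(real n + 1/2) * pi"
  have \<kappa>: "?\<kappa> \<noteq> 0" by (simp add: add_nonneg_eq_0_iff)
  have b: "inner u (dn_basis n) = sqrt 2 * inner u (l2_of (\<lambda>x. cos (?\<kappa> * x)))" for u
    by (simp add: dn_basis_def cosine_def)
  have "?\<kappa>\<^sup>2 * inner (antideriv2 w 0 c) (l2_of (\<lambda>x. cos (?\<kappa> * x))) = - inner w (l2_of (\<lambda>x. cos (?\<kappa> * x)))"
    unfolding inner_antideriv2_cos[OF \<kappa>] cos_half_odd_pi using assms by (simp add: antideriv2_in_dn_dom)
  then show ?thesis
    unfolding b by (simp only: mult.left_commute[of _ "sqrt 2"] mult_minus_right)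
qed

lemma nn_basis_0: "nn_basis 0 = one"
  by (simp add: nn_basis_def cosine_def one_def mu_def)

lemma inner_nn_basis:
  assumes "antideriv2 w 0 c \<in> nn_dom"
  shows "(real m * pi)\<^sup>2 * inner (antideriv2 w 0 c) (nn_basis m) = - inner w (nn_basis m)"
proof (cases "m = 0")
  \<comment> \<open>Frequency 0 is excluded from Green's identity; the claim there is just
    \<open>inner w one = 0\<close>, the Neumann condition at 1.\<close>
  case True
  then show ?thesis using assms by (simp add: antideriv2_in_nn_dom nn_basis_0)
next
  case False
  let ?\<kappa> = "real m * pi"
  have \<kappa>: "?\<kappa> \<noteq> 0" using False by simp
  have b: "inner u (nn_basis m) = mu m * inner u (l2_of (\<lambda>x. cos (?\<kappa> * x)))" for u
    by (simp add: nn_basis_def cosine_def)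
  have "?\<kappa>\<^sup>2 * inner (antideriv2 w 0 c) (l2_of (\<lambda>x. cos (?\<kappa> * x))) = - inner w (l2_of (\<lambda>x. cos (?\<kappa> * x)))"
    unfolding inner_antideriv2_cos[OF \<kappa>] sin_npi using assms by (simp add: antideriv2_in_nn_dom)
  then show ?thesis
    unfolding b by (simp only: mult.left_commute[of _ "mu m"] mult_minus_right)
qed

text \<open>An element of the spectral domain is recovered by integrating its image twice; the
  constants of integration are fixed by the boundary conditions (and, in the Neumann case, by the
  coefficient of the constant function).\<close>

lemma
  fixes a \<omega> :: real
  defines "lam \<equiv> \<lambda>n. a - ((real n + 1/2) * pi)\<^sup>2"
  assumes "spectral_semigroup dn_basis lam \<omega>"
  shows dn_spectral_dom: "spectral_semigroup.dom dn_basis lam = dn_dom"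
    and dn_spectral_gen: "u \<in> dn_dom \<Longrightarrow>
      spectral_semigroup.gen dn_basis lam u = weak_deriv (weak_deriv u) + a *\<^sub>R u"
proof -
  interpret spectral_semigroup dn_basis lam \<omega> by fact
  have coeff: "inner (weak_deriv (weak_deriv u) + a *\<^sub>R u) (dn_basis n) = lam n * inner u (dn_basis n)"
    if u: "u \<in> dn_dom" for u n
  proof -
    obtain w d c where "u = antideriv2 w d c"
      using u H2_cases unfolding dn_dom_def by blast
    moreover from this have "d = 0" using u by (simp add: antideriv2_in_dn_dom)
    ultimately have uw: "u = antideriv2 w 0 c" by simp
    then show ?thesis
      using inner_dn_basis[of w c n] u
      by (simp add: weak_deriv_antideriv2 weak_deriv_volterra_only inner_add_left lam_def left_diff_distrib)
  qed
  show "gen u = weak_deriv (weak_deriv u) + a *\<^sub>R u" if "u \<in> dn_dom" for u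
    using series_coeffs[of "weak_deriv (weak_deriv u) + a *\<^sub>R u"]
    by (simp only: gen_def coeff[OF that])
  show "dom = dn_dom"
  proof safe
    fix u assume u: "u \<in> dn_dom"
    show "u \<in> dom"
      using summable_coeffs[of "weak_deriv (weak_deriv u) + a *\<^sub>R u"]
      by (simp only: dom_def coeff[OF u] mem_Collect_eq)
  next
    fix u assume "u \<in> dom"
    then have su: "summable (\<lambda>n. (lam n * inner u (dn_basis n))\<^sup>2)" by (simp add: dom_def)
    have gen_coeff: "inner (gen u) (dn_basis n) = lam n * inner u (dn_basis n)" for n
      unfolding gen_def by (rule inner_series[OF su])
    define w where "w = gen u - a *\<^sub>R u"
    define v where "v = antideriv2 w 0 (- inner (volterra w) one)"
    have v: "v \<in> dn_dom" by (simp add: v_def antideriv2_in_dn_dom)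
    have "u = v"
    proof (rule eq_if_coeffs_eq)
      fix n
      have "inner w (dn_basis n) = - (((real n + 1/2) * pi)\<^sup>2 * inner u (dn_basis n))"
        unfolding w_def inner_diff_left gen_coeff by (simp add: lam_def left_diff_distrib)
      then have "((real n + 1/2) * pi)\<^sup>2 * inner u (dn_basis n) = ((real n + 1/2) * pi)\<^sup>2 * inner v (dn_basis n)"
        using inner_dn_basis[OF v[unfolded v_def], of n] by (simp add: v_def)
      then show "inner u (dn_basis n) = inner v (dn_basis n)"
        by (simp add: add_nonneg_eq_0_iff)
    qed
    with v show "u \<in> dn_dom" by simp
  qed
qed

lemma
  fixes b \<omega> :: real
  defines "lam \<equiv> \<lambda>m. b - (real m * pi)\<^sup>2"
  assumes "spectral_semigroup nn_basis lam \<omega>"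
  shows nn_spectral_dom: "spectral_semigroup.dom nn_basis lam = nn_dom"
    and nn_spectral_gen: "u \<in> nn_dom \<Longrightarrow>
      spectral_semigroup.gen nn_basis lam u = weak_deriv (weak_deriv u) + b *\<^sub>R u"
proof -
  interpret spectral_semigroup nn_basis lam \<omega> by fact
  have coeff: "inner (weak_deriv (weak_deriv u) + b *\<^sub>R u) (nn_basis m) = lam m * inner u (nn_basis m)"
    if u: "u \<in> nn_dom" for u m
  proof -
    obtain w d c where "u = antideriv2 w d c"
      using u H2_cases unfolding nn_dom_def by blast
    moreover from this have "d = 0" using u by (simp add: antideriv2_in_nn_dom)
    ultimately have uw: "u = antideriv2 w 0 c" by simp
    then show ?thesis
      using inner_nn_basis[of w c m] u
      by (simp add: weak_deriv_antideriv2 weak_deriv_volterra_only inner_add_left lam_def left_diff_distrib)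
  qed
  show "gen u = weak_deriv (weak_deriv u) + b *\<^sub>R u" if "u \<in> nn_dom" for u
    using series_coeffs[of "weak_deriv (weak_deriv u) + b *\<^sub>R u"]
    by (simp only: gen_def coeff[OF that])
  show "dom = nn_dom"
  proof safe
    fix u assume u: "u \<in> nn_dom"
    show "u \<in> dom"
      using summable_coeffs[of "weak_deriv (weak_deriv u) + b *\<^sub>R u"]
      by (simp only: dom_def coeff[OF u] mem_Collect_eq)
  next
    fix u assume "u \<in> dom"
    then have su: "summable (\<lambda>m. (lam m * inner u (nn_basis m))\<^sup>2)" by (simp add: dom_def)
    have gen_coeff: "inner (gen u) (nn_basis m) = lam m * inner u (nn_basis m)" for m
      unfolding gen_def by (rule inner_series[OF su])
    define w where "w = gen u - b *\<^sub>R u"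
    define c where "c = inner u one - inner (volterra (volterra w)) one"
    define v where "v = antideriv2 w 0 c"
    have w: "inner w (nn_basis m) = - ((real m * pi)\<^sup>2 * inner u (nn_basis m))" for m
      unfolding w_def inner_diff_left gen_coeff by (simp add: lam_def left_diff_distrib)
    \<comment> \<open>The zeroth coefficient of w vanishes because its factor (m pi)^2 does. That is
      the compatibility condition making the slope of v zero at 1.\<close>
    have v: "v \<in> nn_dom"
      using w[of 0] by (simp add: v_def antideriv2_in_nn_dom nn_basis_0)
    have "u = v"
    proof (rule eq_if_coeffs_eq)
      fix m
      show "inner u (nn_basis m) = inner v (nn_basis m)"
      proof (cases "m = 0")
        case True
        then show ?thesis
          by (simp add: nn_basis_0 v_def c_def antideriv2_def inner_add_left inner_one_one)
      next
        case False
        have "(real m * pi)\<^sup>2 * inner u (nn_basis m) = (real m * pi)\<^sup>2 * inner v (nn_basis m)"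
          using inner_nn_basis[OF v[unfolded v_def], of m] w[of m] by (auto simp: v_def)
        then show ?thesis using False by simp
      qed
    qed
    with v show "u \<in> nn_dom" by simp
  qed
qed

section \<open>Removing the boundary coupling\<close>

definition lift :: "real \<Rightarrow> l2 \<Rightarrow> l2" where
  "lift s g = s *\<^sub>R (volterra g - inner g one *\<^sub>R one)"

lemma bounded_linear_lift: "bounded_linear (lift s)"
  unfolding lift_def[abs_def]
  by (intro bounded_linear_const_scaleR bounded_linear_sub bounded_linear_volterra
      bounded_linear_scaleR_const bounded_linear_inner_left)

lemma antideriv2_diff:
  "antideriv2 w d c - antideriv2 w' d' c' = antideriv2 (w - w') (d - d') (c - c')"
  by (simp add: antideriv2_def volterra_add volterra_diff volterra_scaleR algebra_simps)

lemma antideriv2_add: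
  "antideriv2 w d c + antideriv2 w' d' c' = antideriv2 (w + w') (d + d') (c + c')"
  by (simp add: antideriv2_def volterra_add volterra_diff volterra_scaleR algebra_simps)

text \<open>The Neumann condition \<open>inner z one = 0\<close> makes \<open>lift\<close> commute with the second derivative:
  \<open>lift s z = s *\<^sub>R volterra z\<close>.\<close>

lemma lift_antideriv2:
  "lift s (antideriv2 z 0 c) =
    antideriv2 (s *\<^sub>R volterra z) (s * c) (- s * inner (antideriv2 z 0 c) one)"
  by (simp add: lift_def antideriv2_def volterra_add volterra_scaleR algebra_simps)

text \<open>For g in \<open>nn_dom\<close>, \<open>lift s g\<close> is in \<open>H2\<close> with
  slope s g(0) at 0 and value 0 at 1. Subtracting it therefore makes the coupling homogeneous,
  preserves the Dirichlet condition, and neither creates nor destroys regularity.\<close>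

lemma decouple_dom:
  "(f - lift s g, g) \<in> dn_dom \<times> nn_dom \<longleftrightarrow> (f, g) \<in> domA s" (is ?dom)
  and decouple_deriv: "(f, g) \<in> domA s \<Longrightarrow>
    weak_deriv (weak_deriv (f - lift s g)) = weak_deriv (weak_deriv f) - lift s (weak_deriv (weak_deriv g))"
    (is "_ \<Longrightarrow> ?deriv")
proof -
  have *: "((f - lift s g \<in> dn_dom) \<longleftrightarrow> (f, g) \<in> domA s) \<and> ((f, g) \<in> domA s \<longrightarrow> ?deriv)"
    if g: "g \<in> nn_dom"
  proof -
    obtain z d c where "g = antideriv2 z d c" using g H2_cases unfolding nn_dom_def by blast
    then have gz: "g = antideriv2 z 0 c" and z: "inner z one = 0"
      using g by (auto simp: antideriv2_in_nn_dom)
    have lift_z: "lift s z = s *\<^sub>R volterra z" by (simp add: lift_def z)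
    have lift_g: "lift s g = antideriv2 (s *\<^sub>R volterra z) (s * c) (- s * inner g one)"
      unfolding gz by (rule lift_antideriv2)
    \<comment> \<open>The left side is the boundary value of \<open>lift s g\<close> at 1.\<close>
    have end_value: "inner (volterra (s *\<^sub>R volterra z)) one + s * c + - s * inner g one = 0"
      by (simp add: gz antideriv2_def inner_add_left inner_one_one volterra_scaleR algebra_simps)
    show ?thesis
    proof (cases "f \<in> H2")
      case True
      then obtain w e k where f: "f = antideriv2 w e k" by (rule H2_cases)
      have diff: "f - lift s g = antideriv2 (w - s *\<^sub>R volterra z) (e - s * c) (k - - s * inner g one)"
        unfolding f lift_g by (rule antideriv2_diff)
      have "(f, g) \<in> domA s \<longleftrightarrow> inner (volterra w) one + e + k = 0 \<and> e = s * c"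
        using z unfolding domA_def f gz
        by (simp add: H2_antideriv2 boundary_value_antideriv2 weak_deriv_antideriv2
            boundary_value_volterra_only)
      moreover have "f - lift s g \<in> dn_dom \<longleftrightarrow> inner (volterra w) one + e + k = 0 \<and> e = s * c"
        unfolding diff antideriv2_in_dn_dom
        using end_value by (auto simp: volterra_diff inner_diff_left)
      moreover have ?deriv
        unfolding diff unfolding f gz by (simp add: weak_deriv_antideriv2 weak_deriv_volterra_only lift_z)
      ultimately show ?thesis by blast
    next
      case False
      have "f - lift s g \<notin> H2"
      proof
        assume "f - lift s g \<in> H2"
        then obtain w e k where "f - lift s g = antideriv2 w e k" by (rule H2_cases)
        then have "f = antideriv2 w e k + lift s g" by (simp add: algebra_simps)
        then show False using False H2_antideriv2 by (simp add: lift_g antideriv2_add)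
      qed
      then show ?thesis using False by (simp add: dn_dom_def domA_def)
    qed
  qed
  moreover have "g \<in> nn_dom" if "(f, g) \<in> domA s"
    using that by (simp add: domA_def nn_dom_def)
  ultimately show ?dom "(f, g) \<in> domA s \<Longrightarrow> ?deriv" by blast+
qed

lemma generates_C0_semigroup_cong:
  assumes "generates_C0_semigroup D A" "D = D'" "\<And>x. x \<in> D' \<Longrightarrow> A x = A' x"
  shows "generates_C0_semigroup D' A'"
proof -
  have "x \<in> D \<and> y = A x \<longleftrightarrow> x \<in> D' \<and> y = A' x" for x y
    using assms(2,3) by auto
  then show ?thesis
    using assms(1) unfolding generates_C0_semigroup_def by simp
qed

lemma opA_generates: "generates_C0_semigroup (domA s) (opA a b)"
proof -
  \<comment> \<open>One nonnegative growth bound for both diagonal parts, as the eigenvalues are at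
    most a and b.\<close>
  define \<omega> where "\<omega> = \<bar>a\<bar> + \<bar>b\<bar>"
  define lam1 where "lam1 n = a - ((real n + 1/2) * pi)\<^sup>2" for n
  define lam2 where "lam2 m = b - (real m * pi)\<^sup>2" for m
  have \<omega>: "0 \<le> \<omega>" "lam1 n \<le> \<omega>" "lam2 n \<le> \<omega>" for n
    using zero_le_power2[of "(real n + 1/2) * pi"] zero_le_power2[of "real n * pi"]
    unfolding \<omega>_def lam1_def lam2_def by linarith+
  interpret S1: spectral_semigroup dn_basis lam1 \<omega>
    by (intro spectral_semigroup.intro orthonormal_basis_dn spectral_semigroup_axioms.intro \<omega>)
  interpret S2: spectral_semigroup nn_basis lam2 \<omega>
    by (intro spectral_semigroup.intro orthonormal_basis_nn spectral_semigroup_axioms.intro \<omega>)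
  define B where "B = Blinfun (\<lambda>g. (a - b) *\<^sub>R lift s g)"
  have B: "blinfun_apply B g = (a - b) *\<^sub>R lift s g" for g
    unfolding B_def
    by (subst bounded_linear_Blinfun_apply) (intro bounded_linear_const_scaleR bounded_linear_lift, rule refl)
  have S1_cont: "continuous_on {0..} (\<lambda>t. S1.semigroup t u)" for u
    by (rule continuous_on_eq[OF S1.continuous_sg[of u]]) (simp add: S1.semigroup_apply)
  have S2_cont: "continuous_on {0..} (\<lambda>t. S2.semigroup t u)" for u
    by (rule continuous_on_eq[OF S2.continuous_sg[of u]]) (simp add: S2.semigroup_apply)
  interpret semigroup_pair S1.semigroup S2.semigroup B \<omega>
    by unfold_locales
       (use S1.C0_semigroup S2.C0_semigroup S1_cont S2_cont S1.norm_semigroup_le S2.norm_semigroup_le \<omega> in auto)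
  have dom: "S1.dom = dn_dom" "S2.dom = nn_dom"
    using dn_spectral_dom[of a \<omega>] nn_spectral_dom[of b \<omega>] S1.spectral_semigroup_axioms S2.spectral_semigroup_axioms
    unfolding lam1_def[abs_def] lam2_def[abs_def] by auto
  have gen: "u \<in> dn_dom \<Longrightarrow> S1.gen u = weak_deriv (weak_deriv u) + a *\<^sub>R u"
      "u \<in> nn_dom \<Longrightarrow> S2.gen u = weak_deriv (weak_deriv u) + b *\<^sub>R u" for u
    using dn_spectral_gen[of a \<omega> u] nn_spectral_gen[of b \<omega> u] S1.spectral_semigroup_axioms S2.spectral_semigroup_axioms
    unfolding lam1_def[abs_def] lam2_def[abs_def] by auto
  have triangular: "generates_C0_semigroup (S1.dom \<times> S2.dom) (\<lambda>p. (S1.gen (fst p) + B (snd p), S2.gen (snd p)))"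
    unfolding generates_C0_semigroup_def
    using C0_semigroup_triangular generator_triangular_iff[OF S1.generator_iff S2.generator_iff] by blast
  \<comment> \<open>P and Q are inverse to each other because neither changes the second component
    on which the lift depends.\<close>
  define P where "P = Blinfun (\<lambda>p. (fst p - lift s (snd p), snd p))"
  define Q where "Q = Blinfun (\<lambda>p. (fst p + lift s (snd p), snd p))"
  have P: "blinfun_apply P p = (fst p - lift s (snd p), snd p)" for p
    unfolding P_def
    by (subst bounded_linear_Blinfun_apply)
       (intro bounded_linear_Pair bounded_linear_sub bounded_linear_fst bounded_linear_snd
          bounded_linear_compose[OF bounded_linear_lift], rule refl)
  have Q: "blinfun_apply Q p = (fst p + lift s (snd p), snd p)" for p
    unfolding Q_def
    by (subst bounded_linear_Blinfun_apply)
       (intro bounded_linear_Pair bounded_linear_add bounded_linear_fst bounded_linear_snd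
          bounded_linear_compose[OF bounded_linear_lift], rule refl)
  have "generates_C0_semigroup {p. P p \<in> S1.dom \<times> S2.dom}
      (\<lambda>p. Q (S1.gen (fst (P p)) + B (snd (P p)), S2.gen (snd (P p))))"
    by (rule generates_C0_semigroup_similar[OF triangular]) (simp_all add: P Q)
  then show ?thesis
  proof (rule generates_C0_semigroup_cong)
    show "{p. P p \<in> S1.dom \<times> S2.dom} = domA s"
      using decouple_dom unfolding dom P by (auto simp: split_paired_all)
    fix p assume "p \<in> domA s"
    then obtain f g where p: "p = (f, g)" and fg: "(f, g) \<in> domA s" by (cases p) auto
    have "f - lift s g \<in> dn_dom" "g \<in> nn_dom" using decouple_dom[of f s g] fg by auto
    moreover have "lift s (u + v) = lift s u + lift s v" "lift s (k *\<^sub>R u) = k *\<^sub>R lift s u" for u v k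
      using bounded_linear.linear[OF bounded_linear_lift[of s]] by (simp_all add: linear_add linear_cmul)
    ultimately show "Q (S1.gen (fst (P p)) + B (snd (P p)), S2.gen (snd (P p))) = opA a b p"
      using decouple_deriv[OF fg]
      by (simp add: p P Q B gen opA_def algebra_simps)
  qed
qed

section \<open>The Riesz basis\<close>

lemma norm_add_sq_le: "(norm (x + y))\<^sup>2 \<le> 2 * (norm x)\<^sup>2 + 2 * (norm y)\<^sup>2"
  for x y :: "'a::real_normed_vector"
proof -
  have "(norm (x + y))\<^sup>2 \<le> (norm x + norm y)\<^sup>2"
    by (intro power_mono norm_triangle_ineq norm_ge_zero)
  also have "\<dots> \<le> 2 * (norm x)\<^sup>2 + 2 * (norm y)\<^sup>2"
    using sum_squares_bound[of "norm x" "norm y"] by (simp add: power2_sum)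
  finally show ?thesis .
qed

lemma closure_span_add:
  fixes B :: "'a::real_normed_vector set"
  assumes "u \<in> closure (span B)" "v \<in> closure (span B)"
  shows "u + v \<in> closure (span B)"
proof -
  obtain x y where "\<And>n. x n \<in> span B" "x \<longlonglongrightarrow> u" "\<And>n. y n \<in> span B" "y \<longlonglongrightarrow> v"
    using assms unfolding closure_sequential by blast
  then show ?thesis
    unfolding closure_sequential
    by (intro exI[of _ "\<lambda>n. x n + y n"]) (auto intro: span_add tendsto_add)
qed

text \<open>The closed span contains all (x, 0). It then contains (0, y) for y in the span of e:
  such y is the second component of a combination of the (f m, e m), whose first component can be
  subtracted. Closedness extends this to all y.\<close>

lemma closure_span_triangular:
  fixes d :: "nat \<Rightarrow> 'a::real_normed_vector" and e :: "nat \<Rightarrow> 'b::real_normed_vector"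
  assumes d: "closure (span (range d)) = UNIV" and e: "closure (span (range e)) = UNIV"
  shows "closure (span (range (\<lambda>n. (d n, 0)) \<union> range (\<lambda>m. (f m, e m)))) = UNIV"
    (is "closure (span ?B) = UNIV")
proof -
  have 1: "(x, 0) \<in> closure (span ?B)" for x
  proof -
    let ?i = "\<lambda>x. (x, 0) :: 'a \<times> 'b"
    have i: "bounded_linear ?i"
      by (intro bounded_linear_Pair bounded_linear_ident bounded_linear_zero)
    have "?i x \<in> ?i ` closure (span (range d))"
      unfolding d by blast
    also have "\<dots> \<subseteq> closure (?i ` span (range d))"
      by (rule closure_bounded_linear_image_subset[OF i])
    also have "?i ` span (range d) = span (?i ` range d)"
      by (rule linear_span_image[OF bounded_linear.linear[OF i], symmetric])
    also have "closure \<dots> \<subseteq> closure (span ?B)"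
      by (intro closure_mono span_mono) auto
    finally show ?thesis .
  qed
  have 2: "(0, y) \<in> closure (span ?B)" for y
  proof -
    have "span (range e) = snd ` span (range (\<lambda>m. (f m, e m)))"
      using linear_span_image[OF bounded_linear.linear[OF bounded_linear_snd], of "range (\<lambda>m. (f m, e m))"]
      by (simp add: image_image)
    also have "\<dots> \<subseteq> {y. (0, y) \<in> closure (span ?B)}"
    proof clarify
      fix x y assume "(x, y) \<in> span (range (\<lambda>m. (f m, e m)))"
      then have "(x, y) \<in> closure (span ?B)"
        using closure_subset span_mono[of "range (\<lambda>m. (f m, e m))" ?B] by blast
      then show "(0, snd (x, y)) \<in> closure (span ?B)"
        using closure_span_add[OF _ 1[of "- x"]] by fastforce
    qed
    finally have "closure (span (range e)) \<subseteq> {y. (0, y) \<in> closure (span ?B)}"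
    proof (rule closure_minimal)
      have "closed ((\<lambda>y. (0, y)) -` closure (span ?B))"
        by (intro closed_vimage closed_closure continuous_intros)
      then show "closed {y. (0, y) \<in> closure (span ?B)}"
        by (simp add: vimage_def)
    qed
    then show ?thesis unfolding e by blast
  qed
  have "p \<in> closure (span ?B)" for p
    using closure_span_add[OF 1[of "fst p"] 2[of "snd p"]] by simp
  then show ?thesis by blast
qed

text \<open>The family is the image of an orthonormal basis under (x, z) -> (x + F z, z) with F (e
  m) = f m. Square summability makes F Hilbert-Schmidt, and (x, z) -> (x - F z, z) is a bounded
  inverse, so f need not be small. On finite sums only the estimate |F z|^2 \<le> K |z|^2 is
  used.\<close>

lemma riesz_basis_triangular:
  fixes d :: "nat \<Rightarrow> 'a::{real_inner,banach}" and e :: "nat \<Rightarrow> 'b::{real_inner,banach}"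
  assumes "orthonormal_basis d" "orthonormal_basis e" and f: "summable (\<lambda>m. (norm (f m))\<^sup>2)"
  shows "riesz_basis (range (\<lambda>n. (d n, 0)) \<union> range (\<lambda>m. (f m, e m)))"
proof -
  interpret d: orthonormal_basis d by fact
  interpret e: orthonormal_basis e by fact
  let ?d = "\<lambda>n. (d n, 0 :: 'b)" and ?e = "\<lambda>m. (f m, e m)"
  define K where "K = (\<Sum>m. (norm (f m))\<^sup>2)"
  have K: "0 \<le> K" unfolding K_def by (rule suminf_nonneg[OF f]) simp
  \<comment> \<open>\<open>riesz_basis\<close> concerns a set with coefficients attached to vectors;
    injectivity and disjointness of the two families let sums over vectors be reindexed by n and
    m.\<close>
  have inj_d: "inj ?d"
    using d.orthonormal by (intro injI) (metis prod.inject zero_neq_one)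
  have inj_e: "inj ?e"
    using e.orthonormal by (intro injI) (metis prod.inject zero_neq_one)
  have e_nz: "e m \<noteq> 0" for m using e.orthonormal[of m m] by auto
  have bounds: "1 / (2 * K + 2) * (\<Sum>v\<in>S. (a v)\<^sup>2) \<le> (norm (\<Sum>v\<in>S. a v *\<^sub>R v))\<^sup>2 \<and>
      (norm (\<Sum>v\<in>S. a v *\<^sub>R v))\<^sup>2 \<le> (2 * K + 2) * (\<Sum>v\<in>S. (a v)\<^sup>2)"
    if S: "finite S" "S \<subseteq> range ?d \<union> range ?e" for S and a :: "'a \<times> 'b \<Rightarrow> real"
  proof -
    define I where "I = ?d -` S"
    define J where "J = ?e -` S"
    have fin: "finite I" "finite J"
      unfolding I_def J_def by (intro finite_vimageI S inj_d inj_e)+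
    have S_eq: "S = ?d ` I \<union> ?e ` J" using S(2) by (auto simp: I_def J_def)
    have disj: "?d ` I \<inter> ?e ` J = {}" using e_nz by (auto dest: sym)
    have split: "(\<Sum>v\<in>S. h v) = (\<Sum>n\<in>I. h (?d n)) + (\<Sum>m\<in>J. h (?e m))" for h :: "'a \<times> 'b \<Rightarrow> 'c::comm_monoid_add"
      unfolding S_eq using fin disj
      by (simp add: sum.union_disjoint sum.reindex inj_on_subset[OF inj_d] inj_on_subset[OF inj_e])
    define X where "X = (\<Sum>n\<in>I. a (?d n) *\<^sub>R d n)"
    define Y where "Y = (\<Sum>m\<in>J. a (?e m) *\<^sub>R f m)"
    define Z where "Z = (\<Sum>m\<in>J. a (?e m) *\<^sub>R e m)"
    have sum_eq: "(\<Sum>v\<in>S. a v *\<^sub>R v) = (X + Y, Z)"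
      unfolding split X_def Y_def Z_def by (simp add: prod_eq_iff fst_sum snd_sum)
    have sq: "(\<Sum>v\<in>S. (a v)\<^sup>2) = (norm X)\<^sup>2 + (norm Z)\<^sup>2"
      unfolding split X_def Z_def by (simp only: d.norm_sum_sq[OF fin(1)] e.norm_sum_sq[OF fin(2)])
    have norm_eq: "(norm (\<Sum>v\<in>S. a v *\<^sub>R v))\<^sup>2 = (norm (X + Y))\<^sup>2 + (norm Z)\<^sup>2"
      unfolding sum_eq by (simp add: norm_Pair)
    have Y: "(norm Y)\<^sup>2 \<le> K * (norm Z)\<^sup>2"
    proof -
      have "norm Y \<le> (\<Sum>m\<in>J. \<bar>a (?e m)\<bar> * norm (f m))"
        unfolding Y_def by (rule order_trans[OF norm_sum]) simp
      then have "(norm Y)\<^sup>2 \<le> (\<Sum>m\<in>J. \<bar>a (?e m)\<bar> * norm (f m))\<^sup>2"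
        by (intro power_mono) auto
      also have "\<dots> \<le> (\<Sum>m\<in>J. \<bar>a (?e m)\<bar>\<^sup>2) * (\<Sum>m\<in>J. (norm (f m))\<^sup>2)"
        by (rule Cauchy_Schwarz_ineq_sum)
      also have "\<dots> \<le> (\<Sum>m\<in>J. \<bar>a (?e m)\<bar>\<^sup>2) * K"
        unfolding K_def by (intro mult_left_mono sum_le_suminf f fin sum_nonneg) auto
      also have "\<dots> = K * (norm Z)\<^sup>2"
        unfolding Z_def e.norm_sum_sq[OF fin(2)] by simp
      finally show ?thesis .
    qed
    have upper: "(norm (X + Y))\<^sup>2 \<le> 2 * (norm X)\<^sup>2 + 2 * (norm Y)\<^sup>2"
      by (rule norm_add_sq_le)
    have lower: "(norm X)\<^sup>2 \<le> 2 * (norm (X + Y))\<^sup>2 + 2 * (norm Y)\<^sup>2"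
      using norm_add_sq_le[of "X + Y" "- Y"] by simp
    have n: "0 \<le> K * (norm X)\<^sup>2" "0 \<le> K * (norm (X + Y))\<^sup>2" using K by simp_all
    \<comment> \<open>The estimates give factor 2 on the first square and 2K + 1 on that of Z; 2K +
      2 dominates both, here and in the reverse bound.\<close>
    have "(norm X)\<^sup>2 + (norm Z)\<^sup>2 \<le> (2 * K + 2) * ((norm (X + Y))\<^sup>2 + (norm Z)\<^sup>2)"
      using lower Y n zero_le_power2[of "norm Z"]
      unfolding distrib_left distrib_right mult.assoc by linarith
    moreover have "(norm (X + Y))\<^sup>2 + (norm Z)\<^sup>2 \<le> (2 * K + 2) * ((norm X)\<^sup>2 + (norm Z)\<^sup>2)"
      using upper Y n zero_le_power2[of "norm Z"]
      unfolding distrib_left distrib_right mult.assoc by linarith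
    ultimately show ?thesis
      unfolding sq norm_eq using K by (simp add: pos_divide_le_eq mult.commute)
  qed
  have "0 < 1 / (2 * K + 2)" "0 < 2 * K + 2" using K by simp_all
  then show ?thesis
    unfolding riesz_basis_def
    using closure_span_triangular[OF d.dense_span e.dense_span, of f] bounds by blast
qed

text \<open>Here \<open>r m\<close> is plus or minus i \<rho> with \<rho> real and \<rho> \<ge> m,
  so sinh and cosh become sine and cosine. The decay 1/m comes from the factor \<open>r m\<close>;
  the danger is a small cosine, and \<rho> is too close to m pi for that.\<close>

lemma abs_phi21_le:
  assumes r: "(r m)\<^sup>2 = of_real (b - a - (real m)\<^sup>2 * pi\<^sup>2)"
    and m: "1 \<le> m" "\<bar>b - a\<bar> \<le> real m" and x: "x \<in> {0<..<1}"
  shows "\<bar>phi21 a b s r m x\<bar> \<le> 2 * sqrt 2 * \<bar>s\<bar> / real m"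
proof -
  have m1: "1 \<le> real m" using m by simp
  have mm: "real m \<le> (real m)\<^sup>2" using m1 by (simp add: power2_eq_square)
  have pi3: "9 \<le> pi\<^sup>2" using power_mono[of 3 pi 2] pi_gt3 by simp
  have mpi: "9 * (real m)\<^sup>2 \<le> (real m)\<^sup>2 * pi\<^sup>2"
    using mult_left_mono[OF pi3, of "(real m)\<^sup>2"] by (simp add: mult.commute)
  define \<rho> where "\<rho> = sqrt ((real m)\<^sup>2 * pi\<^sup>2 - (b - a))"
  have ge: "(real m)\<^sup>2 \<le> (real m)\<^sup>2 * pi\<^sup>2 - (b - a)"
    using m mm mpi by linarith
  then have \<rho>2: "\<rho>\<^sup>2 = (real m)\<^sup>2 * pi\<^sup>2 - (b - a)"
    unfolding \<rho>_def using zero_le_power2[of "real m"] by (intro real_sqrt_pow2) linarith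
  have \<rho>m: "real m \<le> \<rho>"
    unfolding \<rho>_def using ge by (rule real_le_rsqrt)
  then have \<rho>0: "0 < \<rho>" using m1 by linarith
  have cos_\<rho>: "1/2 \<le> \<bar>cos \<rho>\<bar>"
  proof -
    \<comment> \<open>Its product with \<rho> + m pi is a difference of squares, equal to a - b; as
      that sum is at least m \<ge> |b - a|, this gives |\<delta>| \<le> 1.\<close>
    define \<delta> where "\<delta> = \<rho> - real m * pi"
    have "\<delta> * (\<rho> + real m * pi) = - (b - a)"
      using \<rho>2 by (simp add: \<delta>_def algebra_simps power2_eq_square)
    then have "\<bar>\<delta>\<bar> * \<bar>\<rho> + real m * pi\<bar> = \<bar>b - a\<bar>"
      by (simp flip: abs_mult)
    moreover have "real m \<le> \<bar>\<rho> + real m * pi\<bar>"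
      using \<rho>m by (intro order_trans[OF _ abs_ge_self]) (simp add: add_increasing2)
    then have "\<bar>\<delta>\<bar> * real m \<le> \<bar>\<delta>\<bar> * \<bar>\<rho> + real m * pi\<bar>"
      by (rule mult_left_mono) simp
    ultimately have "\<bar>\<delta>\<bar> * real m \<le> 1 * real m" using m by linarith
    then have "\<bar>\<delta>\<bar> \<le> 1" by (rule mult_right_le_imp_le) (use m1 in simp)
    \<comment> \<open>Since pi > 3, the distance 1 is below pi/3, where the cosine is 1/2.\<close>
    then have "cos (pi / 3) \<le> cos \<bar>\<delta>\<bar>"
      using pi_gt3 by (intro cos_monotone_0_pi_le) auto
    then have "1/2 \<le> cos \<delta>" by (simp add: cos_60)
    moreover have "cos \<rho> = (-1) ^ m * cos \<delta>"
      using cos_add[of "real m * pi" \<delta>] by (simp add: \<delta>_def)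
    ultimately show ?thesis by (simp add: abs_mult power_abs)
  qed
  \<comment> \<open>Resonance would make \<rho> an odd multiple of pi/2, a zero of the
    cosine.\<close>
  have not_Delta2: "m \<notin> Delta2 a b"
  proof
    assume "m \<in> Delta2 a b"
    then obtain n where "4 * (b - a) = (4 * (real m)\<^sup>2 - (2 * real n + 1)\<^sup>2) * pi\<^sup>2"
      by (auto simp: Delta2_def Delta_def)
    then have "\<rho>\<^sup>2 = ((real n + 1/2) * pi)\<^sup>2"
      unfolding \<rho>2 by (simp add: power2_eq_square algebra_simps)
    then have "\<rho> = (real n + 1/2) * pi"
      by (rule power2_eq_imp_eq) (use \<rho>0 in auto)
    then show False using cos_\<rho> by (simp add: cos_half_odd_pi)
  qed
  have not_eq: "b - a \<noteq> (real m)\<^sup>2 * pi\<^sup>2"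
    using \<rho>2 \<rho>0 by auto
  have "(\<i> * r m)\<^sup>2 = (of_real \<rho>)\<^sup>2"
    unfolding power_mult_distrib r of_real_power[symmetric] \<rho>2 by simp
  then have "\<i> * r m = of_real \<rho> \<or> \<i> * r m = - of_real \<rho>"
    by (simp add: power2_eq_iff)
  \<comment> \<open>The sign records which square root was chosen; it affects neither |r m|, nor the
    cosine, nor the bound on the sine.\<close>
  then obtain \<sigma> where \<sigma>: "\<i> * r m = of_real \<sigma>" "\<sigma> = \<rho> \<or> \<sigma> = - \<rho>"
    by (metis of_real_minus)
  have norm_r: "norm (r m) = \<rho>"
    using arg_cong[OF \<sigma>(1), of norm] \<sigma>(2) \<rho>0 by (auto simp: norm_mult)
  have "cosh (r m) = of_real (cos \<sigma>)"
    unfolding cosh_conv_cos \<sigma>(1) by (rule cos_of_real)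
  then have norm_cosh: "1/2 \<le> norm (cosh (r m))"
    using \<sigma>(2) cos_\<rho> by auto
  have "\<i> * (r m * of_real (1 - x)) = of_real (\<sigma> * (1 - x))"
    by (simp only: mult.assoc[symmetric] \<sigma>(1) of_real_mult)
  then have "sinh (r m * of_real (1 - x)) = - \<i> * of_real (sin (\<sigma> * (1 - x)))"
    unfolding sinh_conv_sin by (simp only: sin_of_real)
  then have norm_sinh: "norm (sinh (r m * of_real (1 - x))) \<le> 1"
    by (simp add: norm_mult)
  have "\<bar>phi21 a b s r m x\<bar> \<le> norm (- (of_real (s * mu m) / (r m * cosh (r m))) * sinh (r m * of_real (1 - x)))"
    unfolding phi21_def using not_Delta2 not_eq by (simp only: if_False abs_Re_le_cmod)
  also have "\<dots> = \<bar>s * mu m\<bar> / (\<rho> * norm (cosh (r m))) * norm (sinh (r m * of_real (1 - x)))"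
    by (simp only: norm_mult norm_divide norm_minus_cancel norm_r norm_of_real)
  also have "\<dots> \<le> \<bar>s * mu m\<bar> / (real m * (1/2)) * 1"
    using \<rho>m \<rho>0 norm_cosh norm_sinh m1
    by (intro mult_mono divide_left_mono mult_pos_pos) auto
  also have "\<dots> = 2 * sqrt 2 * \<bar>s\<bar> / real m"
    using m by (simp add: mu_def abs_mult)
  finally show ?thesis .
qed

lemma summable_norm_phi21:
  assumes "\<And>m. (r m)\<^sup>2 = of_real (b - a - (real m)\<^sup>2 * pi\<^sup>2)"
  shows "summable (\<lambda>m. (norm (l2_of (phi21 a b s r m)))\<^sup>2)"
proof (rule summable_comparison_test_ev)
  \<comment> \<open>Indices below max 1 m0, among them all exceptional cases of
    \<open>phi21\<close>, contribute finitely many terms to the series.\<close>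
  obtain m0 where m0: "\<bar>b - a\<bar> \<le> real m0" using real_arch_simple by blast
  show "\<forall>\<^sub>F m in sequentially. norm ((norm (l2_of (phi21 a b s r m)))\<^sup>2) \<le> (2 * sqrt 2 * \<bar>s\<bar>)\<^sup>2 * inverse (real m ^ 2)"
    using eventually_ge_at_top[of "max 1 m0"]
  proof eventually_elim
    case (elim m)
    have "norm (l2_of (phi21 a b s r m)) \<le> 2 * sqrt 2 * \<bar>s\<bar> / real m"
    proof (rule norm_l2_of_le)
      show "\<bar>phi21 a b s r m x\<bar> \<le> 2 * sqrt 2 * \<bar>s\<bar> / real m" if "x \<in> {0<..<1}" for x
        by (rule abs_phi21_le) (use assms elim m0 that in auto)
    qed simp
    then have "(norm (l2_of (phi21 a b s r m)))\<^sup>2 \<le> (2 * sqrt 2 * \<bar>s\<bar> / real m)\<^sup>2"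
      by (intro power_mono) auto
    then show ?case
      unfolding power_divide by (simp only: divide_inverse real_norm_def abs_power2)
  qed
  show "summable (\<lambda>m. (2 * sqrt 2 * \<bar>s\<bar>)\<^sup>2 * inverse (real m ^ 2))"
    by (intro summable_mult inverse_power_summable) simp
qed

lemma phi1_eq: "phi1 n = (dn_basis n, 0)"
  unfolding phi1_def dn_basis_def cosine_def
  by (subst l2_of_cmult) (auto intro!: square_integrable_continuous continuous_intros)

lemma phi2_eq: "phi2 a b s r m = (l2_of (phi21 a b s r m), nn_basis m)"
  unfolding phi2_def nn_basis_def cosine_def
  by (subst l2_of_cmult) (auto intro!: square_integrable_continuous continuous_intros)

theorem lemma2:
  fixes a b s :: real and r :: "nat \<Rightarrow> complex"
  assumes "s \<noteq> 0"
    and "\<And>m. (r m)\<^sup>2 = of_real (b - a - (real m)\<^sup>2 * pi\<^sup>2)"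
  shows "riesz_basis (range phi1 \<union> range (phi2 a b s r)) \<and>
    generates_C0_semigroup (domA s) (opA a b)"
proof
  have "riesz_basis (range (\<lambda>n. (dn_basis n, 0)) \<union> range (\<lambda>m. (l2_of (phi21 a b s r m), nn_basis m)))"
    by (intro riesz_basis_triangular orthonormal_basis_dn orthonormal_basis_nn summable_norm_phi21 assms)
  then show "riesz_basis (range phi1 \<union> range (phi2 a b s r))"
    by (simp only: phi1_eq[abs_def] phi2_eq[abs_def])
  show "generates_C0_semigroup (domA s) (opA a b)"
    by (rule opA_generates)
qed

end
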